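(* Let $N\ge 2$, let $A^{(n)}\in\mathbb{R}^{I_n\times R}$ ($n=1,\dots,N$), $T=\sum_n I_n$, $\mu>0$, and let $H=J^TJ\in\mathbb{R}^{RT\times RT}$ be the approximate Hessian of the rank-$R$ CP model at $(A^{(1)},\dots,A^{(N)})$ (see context). Put $C^{(n)}=A^{(n)T}A^{(n)}$, $\Gamma^{(n,m)}=\circledast_{k\neq n,m}C^{(k)}$, $\Gamma^{(n)}=\Gamma^{(n,n)}$, $\widetilde\Gamma^{(n)}_\mu=(\Gamma^{(n)}+\mu I_R)^{-1}$, let $K=[K^{(n,m)}]_{n,m=1}^N\in\mathbb{R}^{NR^2\times NR^2}$ with blocks $K^{(n,m)}=(1-\delta_{n,m})\,P_R\,\operatorname{diag}(\operatorname{vec}(\Gamma^{(n,m)}))\in\mathbb{R}^{R^2\times R^2}$, let $\Psi_\mu=\operatorname{blkdiag}(\widetilde\Gamma^{(n)}_\mu\otimes C^{(n)})_{n=1}^N$, and let $$B_\mu=\begin{cases}(K^{-1}+\Psi_\mu)^{-1}, & K\text{ invertible},\\ K\,(I_{NR^2}+\Psi_\mu K)^{-1}, & \text{otherwise}.\end{cases}$$ Then the inverse of the damped approximate Hessian $H_\mu=H+\mu I_{RT}$ is $$H_\mu^{-1}=\widetilde G_\mu-L_\mu\,B_\mu\,L_\mu^T,$$ where $$\widetilde G_\mu=\operatorname{blkdiag}\big(\widetilde\Gamma^{(n)}_\mu\otimes I_{I_n}\big)_{n=1}^N\in\mathbb{R}^{RT\times RT},\qquad L_\mu=\operatorname{blkdiag}\big(\widetilde\Gamma^{(n)}_\mu\otimes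 A^{(n)}\big)_{n=1}^N\in\mathbb{R}^{RT\times NR^2}.$$
   Context: Notation: $\otimes$ is the Kronecker product, $\circledast$ the Hadamard (entrywise) product; $\circledast_{k\ne n,m}$ is over all $k\in\{1,\dots,N\}\setminus\{n,m\}$, and an empty Hadamard product of $R\times R$ matrices is the all-ones matrix. $\delta_{n,m}$ is the Kronecker delta. $\operatorname{vec}$ of a matrix stacks its columns; $\operatorname{vec}$ of a tensor lists entries with the first index running fastest. $P_R$ is the $R^2\times R^2$ permutation matrix with $P_R\operatorname{vec}(X^T)=\operatorname{vec}(X)$ for every $R\times R$ matrix $X$. $\operatorname{blkdiag}(M_n)_{n=1}^N$ is the block diagonal matrix with (possibly rectangular) diagonal blocks $M_1,\dots,M_N$. CP model: with $a^{(n)}_r$ the $r$-th column of $A^{(n)}$, $\widehat{\mathcal{Y}}=\sum_{r=1}^R a^{(1)}_r\circ\cdots\circ a^{(N)}_r\in\mathbb{R}^{I_1\times\cdots\times I_N}$ ($\circ$ the outer product). The parameter vector is $a=[\operatorname{vec}(A^{(1)})^T,\dots,\operatorname{vec}(A^{(N)})^T]^T\in\mathbb{R}^{RT}$, and $J\in\mathbb{R}^{(\prod_n I_n)\times RT}$ is the Jacobian of $\operatorname{vec}(\widehat{\mathcal{Y}})$ with respect to $a$. *)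

theory Defs
  imports "HOL-Analysis.Derivative" "Jordan_Normal_Form.Gauss_Jordan_Elimination"
begin

text \<open>All indices (modes, rows, columns, rank-one components) are 0-based.\<close>

definition kron :: "real mat \<Rightarrow> real mat \<Rightarrow> real mat" where
  "kron A B = Matrix.mat (dim_row A * dim_row B) (dim_col A * dim_col B)
     (\<lambda>(i, j). A $$ (i div dim_row B, j div dim_col B) * B $$ (i mod dim_row B, j mod dim_col B))"

text \<open>The empty Hadamard product is the all-ones matrix, hence the explicit size.\<close>

definition hadamard_prod :: "nat \<Rightarrow> nat set \<Rightarrow> (nat \<Rightarrow> real mat) \<Rightarrow> real mat" where
  "hadamard_prod R S M = Matrix.mat R R (\<lambda>(r, s). \<Prod>k\<in>S. M k $$ (r, s))"

definition blkdiag :: "nat \<Rightarrow> (nat \<Rightarrow> real mat) \<Rightarrow> real mat" where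
  "blkdiag N M = diag_block_mat (map M [0..<N])"

definition block_mat :: "nat \<Rightarrow> nat \<Rightarrow> (nat \<Rightarrow> nat \<Rightarrow> real mat) \<Rightarrow> real mat" where
  "block_mat N b M = Matrix.mat (N * b) (N * b) (\<lambda>(i, j). M (i div b) (j div b) $$ (i mod b, j mod b))"

definition vec_of_mat :: "real mat \<Rightarrow> real Matrix.vec" where
  "vec_of_mat X = Matrix.vec (dim_row X * dim_col X) (\<lambda>p. X $$ (p mod dim_row X, p div dim_row X))"

definition diag_of_vec :: "real Matrix.vec \<Rightarrow> real mat" where
  "diag_of_vec v = mat_diag (dim_vec v) (\<lambda>i. v $ i)"

definition comm_mat :: "nat \<Rightarrow> real mat" where
  "comm_mat R = Matrix.mat (R\<^sup>2) (R\<^sup>2) (\<lambda>(i, j). if j = (i mod R) * R + i div R then 1 else 0)"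

text \<open>Unspecified unless the argument is invertible, see \<open>inverse_mat_inverts\<close>.\<close>

definition inverse_mat :: "real mat \<Rightarrow> real mat" where
  "inverse_mat M = the (mat_inverse M)"

text \<open>A tensor of order \<open>N\<close> maps a multi-index, given by its components \<open>idx 0, \<dots>, idx (N - 1)\<close>,
  to an entry. \<open>tensor_vec N I Y\<close> is the vectorization of a tensor of size
  \<open>I 0 \<times> \<dots> \<times> I (N - 1)\<close>, the first index running fastest: position \<open>p\<close> is decoded in mixed radix.\<close>

type_synonym tensor = "(nat \<Rightarrow> nat) \<Rightarrow> real"

definition outer :: "nat \<Rightarrow> (nat \<Rightarrow> real Matrix.vec) \<Rightarrow> tensor" where
  "outer N v idx = (\<Prod>n<N. v n $ idx n)"

definition cp_tensor :: "nat \<Rightarrow> nat \<Rightarrow> (nat \<Rightarrow> real mat) \<Rightarrow> tensor" where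
  "cp_tensor N R A idx = (\<Sum>r<R. outer N (\<lambda>n. col (A n) r) idx)"

definition tensor_vec :: "nat \<Rightarrow> (nat \<Rightarrow> nat) \<Rightarrow> tensor \<Rightarrow> real Matrix.vec" where
  "tensor_vec N I Y =
     Matrix.vec (\<Prod>n<N. I n) (\<lambda>p. Y (\<lambda>n. p div (\<Prod>k<n. I k) mod I n))"

definition cp_params :: "nat \<Rightarrow> (nat \<Rightarrow> real mat) \<Rightarrow> real Matrix.vec" where
  "cp_params N A = vec_of_list (concat (map (\<lambda>n. list_of_vec (vec_of_mat (A n))) [0..<N]))"

text \<open>\<open>cp_factors\<close> recovers the factor matrices from the parameter vector, see
  \<open>cp_factors_cp_params\<close>; through it the vectorized model becomes a function of the parameters.\<close>

definition cp_factors :: "(nat \<Rightarrow> nat) \<Rightarrow> nat \<Rightarrow> real Matrix.vec \<Rightarrow> nat \<Rightarrow> real mat" where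
  "cp_factors I R a n = Matrix.mat (I n) R (\<lambda>(i, r). a $ ((\<Sum>k<n. I k * R) + r * I n + i))"

definition cp_model :: "nat \<Rightarrow> (nat \<Rightarrow> nat) \<Rightarrow> nat \<Rightarrow> real Matrix.vec \<Rightarrow> real Matrix.vec" where
  "cp_model N I R a = tensor_vec N I (cp_tensor N R (cp_factors I R a))"

text \<open>Matrix of partial derivatives; \<open>x |\<^sub>v j \<mapsto> t\<close> replaces the \<open>j\<close>-th coordinate of \<open>x\<close> by \<open>t\<close>.\<close>

definition jacobian :: "(real Matrix.vec \<Rightarrow> real Matrix.vec) \<Rightarrow> real Matrix.vec \<Rightarrow> real mat" where
  "jacobian f x = Matrix.mat (dim_vec (f x)) (dim_vec x)
     (\<lambda>(i, j). deriv (\<lambda>t. f (x |\<^sub>v j \<mapsto> t) $ i) (x $ j))"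

lemma inverse_mat_inverts:
  assumes "invertible_mat M" and M: "M \<in> carrier_mat n n"
  shows "inverse_mat M \<in> carrier_mat n n" "M * inverse_mat M = 1\<^sub>m n" "inverse_mat M * M = 1\<^sub>m n"
proof -
  from assms obtain X where X: "M * X = 1\<^sub>m n" "X * M = 1\<^sub>m (dim_row X)"
    by (auto simp: invertible_mat_def inverts_mat_def)
  have "dim_col X = n" using arg_cong[OF X(1), of dim_col] by simp
  moreover have "dim_row X = n" using arg_cong[OF X(2), of dim_col] M by simp
  ultimately have XC: "X \<in> carrier_mat n n" by auto
  have U: "M \<in> Units (ring_mat TYPE(real) n ())"
    unfolding Units_def using X XC M by (auto simp: ring_mat_simps)
  then obtain Y where Y: "mat_inverse M = Some Y"
    using mat_inverse(1)[OF M, where b = "()"] by (cases "mat_inverse M") auto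
  from mat_inverse(2)[OF M Y] Y
  show "inverse_mat M \<in> carrier_mat n n" "M * inverse_mat M = 1\<^sub>m n" "inverse_mat M * M = 1\<^sub>m n"
    by (auto simp: inverse_mat_def)
qed

lemma comm_mat_vec_transpose:
  assumes X: "X \<in> carrier_mat R R"
  shows "comm_mat R *\<^sub>v vec_of_mat X\<^sup>T = vec_of_mat X"
proof (rule eq_vecI)
  show "dim_vec (comm_mat R *\<^sub>v vec_of_mat X\<^sup>T) = dim_vec (vec_of_mat X)"
    using X by (simp add: comm_mat_def vec_of_mat_def power2_eq_square)
  fix i assume "i < dim_vec (vec_of_mat X)"
  then have i: "i < R * R" using X by (simp add: vec_of_mat_def)
  then have R: "R > 0" by (cases R) auto
  have d: "i div R < R" using i by (simp add: less_mult_imp_div_less)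
  have m: "i mod R < R" using R by simp
  let ?j = "(i mod R) * R + i div R"
  have "?j < (i mod R) * R + R" using d by simp
  also have "\<dots> \<le> R * R" using mult_le_mono1[of "Suc (i mod R)" R R] m by simp
  finally have j: "?j < R * R" .
  have "(comm_mat R *\<^sub>v vec_of_mat X\<^sup>T) $ i =
      (\<Sum>k\<in>{0..<R * R}. (if k = ?j then 1 else 0) * vec_of_mat X\<^sup>T $ k)"
    using i X
    by (auto simp: comm_mat_def scalar_prod_def power2_eq_square vec_of_mat_def intro!: sum.cong)
  also have "\<dots> = (\<Sum>k\<in>{0..<R * R}. if k = ?j then vec_of_mat X\<^sup>T $ ?j else 0)"
    by (intro sum.cong) auto
  also have "\<dots> = vec_of_mat X\<^sup>T $ ?j" using j by simp
  also have "\<dots> = vec_of_mat X $ i" using i j X d m R by (simp add: vec_of_mat_def)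
  finally show "(comm_mat R *\<^sub>v vec_of_mat X\<^sup>T) $ i = vec_of_mat X $ i" .
qed

lemma concat_map_upt_nth:
  "n < N \<Longrightarrow> j < length (f n) \<Longrightarrow>
   concat (map f [0..<N]) ! ((\<Sum>k<n. length (f k)) + j) = f n ! j"
proof (induction N)
  case (Suc N)
  have len: "length (concat (map f [0..<m])) = (\<Sum>k<m. length (f k))" for m
    by (induction m) auto
  show ?case
  proof (cases "n = N")
    case True
    then show ?thesis by (simp add: nth_append len)
  next
    case False
    then have n: "n < N" using Suc.prems by simp
    have "(\<Sum>k<n. length (f k)) + j < (\<Sum>k<Suc n. length (f k))" using Suc.prems by simp
    also have "\<dots> \<le> (\<Sum>k<N. length (f k))" by (rule sum_mono2) (use n in auto)
    finally show ?thesis using Suc n by (simp add: nth_append len)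
  qed
qed simp

lemma cp_factors_cp_params:
  assumes A: "\<And>k. k < N \<Longrightarrow> A k \<in> carrier_mat (I k) R" and n: "n < N"
  shows "cp_factors I R (cp_params N A) n = A n"
proof (rule eq_matI)
  fix i r assume "i < dim_row (A n)" "r < dim_col (A n)"
  then have i: "i < I n" and r: "r < R" using A[OF n] by auto
  let ?f = "\<lambda>n. list_of_vec (vec_of_mat (A n))"
  have l: "length (?f k) = I k * R" if "k < N" for k
    using A[OF that] by (simp add: vec_of_mat_def)
  have "r * I n + i < r * I n + I n" using i by simp
  also have "\<dots> \<le> I n * R" using mult_le_mono1[of "Suc r" R "I n"] r by (simp add: mult.commute)
  finally have j: "r * I n + i < I n * R" .
  have s: "(\<Sum>k<n. length (?f k)) = (\<Sum>k<n. I k * R)" using n l by (intro sum.cong) auto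
  have "cp_factors I R (cp_params N A) n $$ (i, r) =
      concat (map ?f [0..<N]) ! ((\<Sum>k<n. I k * R) + (r * I n + i))"
    using i r by (simp add: cp_factors_def cp_params_def vec_of_list_index add.assoc)
  also have "\<dots> = ?f n ! (r * I n + i)"
    using concat_map_upt_nth[OF n, of "r * I n + i" ?f] j l[OF n] s by simp
  also have "\<dots> = A n $$ (i, r)"
    using A[OF n] i j by (simp add: list_of_vec_index vec_of_mat_def)
  finally show "cp_factors I R (cp_params N A) n $$ (i, r) = A n $$ (i, r)" .
qed (use A[OF n] in \<open>auto simp: cp_factors_def\<close>)

end

theory Submission
  imports Defs "Jordan_Normal_Form.Determinant"
begin

text \<open>Writing \<open>Z\<close> for the block diagonal matrix with blocks \<open>I \<otimes> A n\<close>, the entries of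
  \<open>J\<^sup>T J\<close> give \<open>H\<mu> = D + Z K Z\<^sup>T\<close>, where \<open>D\<close> is block diagonal with blocks
  \<open>(\<Gamma> n n + \<mu> I) \<otimes> I\<close>. Then \<open>G = D\<inverse>\<close>, \<open>L = G Z\<close> and \<open>\<Psi> = Z\<^sup>T G Z\<close>, so the formula
  is Woodbury's identity. Both \<open>H\<mu>\<close> and \<open>\<Gamma> n n + \<mu> I\<close> are Gram matrices plus \<open>\<mu> I\<close>, hence
  invertible. If \<open>x + \<Psi> K x = 0\<close>, then \<open>y = G Z K x\<close> satisfies \<open>H\<mu> y = 0\<close> and \<open>x = - Z\<^sup>T y\<close>,
  so \<open>I + \<Psi> K\<close> is injective as well.\<close>

section \<open>Block and mixed-radix indices\<close>

text \<open>A global index is an offset plus a position inside a block. Rows of block matrices and,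
  with constant \<open>d\<close>, pairs \<open>r * b + i\<close> both have this form, so one
  splitting rule serves both.\<close>

lemma sum_less_blocks:
  fixes f :: "nat \<Rightarrow> 'a :: comm_monoid_add" and N :: nat
  shows "(\<Sum>p<(\<Sum>k<N. d k). f p) = (\<Sum>n<N. \<Sum>i<d n. f ((\<Sum>k<n. d k) + i))"
proof (induction N)
  case (Suc N)
  have split: "(\<Sum>p<a + b. f p) = (\<Sum>p<a. f p) + (\<Sum>i<b. f (a + i))" for a b
    by (induction b) (auto simp: ac_simps)
  show ?case by (simp add: split Suc)
qed simp

lemma block_index_less:
  "n < (N :: nat) \<Longrightarrow> i < d n \<Longrightarrow> (\<Sum>k<n. d k) + i < (\<Sum>k<N. d k :: nat)"
proof (induction N)
  case (Suc N)
  then show ?case by (cases "n = N") auto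
qed simp

lemma block_index_cases:
  assumes "p < (\<Sum>k<(N :: nat). d k :: nat)"
  obtains n i where "n < N" "i < d n" "p = (\<Sum>k<n. d k) + i"
proof -
  have "p < (\<Sum>k<N. d k) \<Longrightarrow> \<exists>n<N. \<exists>i<d n. p = (\<Sum>k<n. d k) + i"
  proof (induction N)
    case (Suc N)
    show ?case
    proof (cases "p < (\<Sum>k<N. d k)")
      case True
      then show ?thesis using Suc.IH less_SucI by blast
    next
      case False
      then show ?thesis
        using Suc.prems by (intro exI[of _ N] exI[of _ "p - (\<Sum>k<N. d k)"] conjI) auto
    qed
  qed simp
  with assms that show thesis by blast
qed

text \<open>If \<open>n < m\<close>, an index in block \<open>n\<close> lies below the offset at
  which block \<open>m\<close> begins, so blocks do not overlap. For constant \<open>d\<close> this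
  is the uniqueness of quotient and remainder.\<close>

lemma block_index_eq_iff:
  assumes "i < d n" "j < d m"
  shows "(\<Sum>k<n. d k) + i = (\<Sum>k<(m :: nat). d k) + (j :: nat) \<longleftrightarrow> n = m \<and> i = j"
proof -
  have "(\<Sum>k<n. d k) + i < (\<Sum>k<m. d k) + j" if "n < m" "i < d n" for n m i j :: nat
    using block_index_less[of n m i d] that by simp
  from this[of n m i j] this[of m n j i] assms show ?thesis
    by (cases n m rule: linorder_cases) auto
qed

lemma prod_index_less:
  assumes "r < a" "i < (b :: nat)"
  shows "r * b + i < a * b"
proof -
  have "r * b + i < Suc r * b" using assms by simp
  also have "\<dots> \<le> a * b" using assms by (intro mult_le_mono1) simp
  finally show ?thesis .
qed

lemma prod_index_cases:
  assumes "p < a * (b :: nat)"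
  obtains r i where "r < a" "i < b" "p = r * b + i"
proof
  have "b > 0" using assms by (cases b) auto
  then show "p mod b < b" by simp
  show "p div b < a" using assms by (simp add: less_mult_imp_div_less)
qed simp

lemma prod_index_div_mod:
  assumes "i < (b :: nat)"
  shows "(r * b + i) div b = r" "(r * b + i) mod b = i"
  using assms by simp_all

lemma sum_less_mult:
  fixes f :: "nat \<Rightarrow> 'a :: comm_monoid_add"
  shows "(\<Sum>p<a * b. f p) = (\<Sum>r<a. \<Sum>i<b. f (r * b + i))"
  using sum_less_blocks[of f "\<lambda>_. b" a] by simp

text \<open>Distributivity of products over sums, the multi-indices being enumerated by the
  mixed-radix digits of \<open>p\<close> exactly as in \<open>tensor_vec\<close>. Because of it,
  inner products of vectorized rank-one tensors factor over the modes. The induction splits off the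
  last mode, which carries the most significant digit.\<close>

lemma sum_mixed_radix:
  fixes f :: "nat \<Rightarrow> nat \<Rightarrow> 'a :: comm_semiring_1"
  shows "(\<Sum>p<(\<Prod>n<N. I n). \<Prod>n<N. f n (p div (\<Prod>k<n. I k) mod I n)) = (\<Prod>n<N. \<Sum>i<I n. f n i)"
proof (induction N)
  case (Suc N)
  let ?P = "\<Prod>k<N. I k"
  \<comment> \<open>A digit below the top one ignores multiples of \<open>?P\<close>, since
    \<open>?P\<close> is divisible by \<open>(\<Prod>k<n. I k) * I n\<close>. If an earlier mode has
    size 0, both quotients are 0 by the convention for division by 0.\<close>
  have dig: "(x * ?P + q) div (\<Prod>k<n. I k) mod I n = q div (\<Prod>k<n. I k) mod I n" if "n < N" for x q n
  proof (cases "(\<Prod>k<n. I k) = 0")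
    case False
    have "?P = prod I {0..<Suc n} * prod I {Suc n..<N}"
      using that by (subst prod.atLeastLessThan_concat) (auto simp: atLeast0LessThan)
    then have "?P = (\<Prod>k<n. I k) * I n * prod I {Suc n..<N}"
      by (simp add: atLeast0LessThan)
    then have "x * ?P + q = q + (\<Prod>k<n. I k) * (I n * (x * (\<Prod>k\<in>{Suc n..<N}. I k)))"
      by (simp add: ac_simps)
    then have "(x * ?P + q) div (\<Prod>k<n. I k) = I n * (x * (\<Prod>k\<in>{Suc n..<N}. I k)) + q div (\<Prod>k<n. I k)"
      by (simp only: div_mult_self2[OF False])
    then show ?thesis by simp
  qed (simp only: div_by_0 simp_thms)
  have top: "(x * ?P + q) div ?P mod I N = x" if "q < ?P" "x < I N" for x q
    using that by (simp only: prod_index_div_mod mod_less)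
  have "(\<Sum>p<(\<Prod>n<Suc N. I n). \<Prod>n<Suc N. f n (p div (\<Prod>k<n. I k) mod I n)) =
      (\<Sum>x<I N. \<Sum>q<?P. (\<Prod>n<N. f n ((x * ?P + q) div (\<Prod>k<n. I k) mod I n)) *
         f N ((x * ?P + q) div ?P mod I N))"
    by (simp only: prod.lessThan_Suc mult.commute[of ?P] sum_less_mult)
  also have "\<dots> = (\<Sum>x<I N. \<Sum>q<?P. (\<Prod>n<N. f n (q div (\<Prod>k<n. I k) mod I n)) * f N x)"
  proof (intro sum.cong refl arg_cong2[where f = "(*)"] prod.cong)
    fix x q n assume "n \<in> {..<N}"
    then show "f n ((x * ?P + q) div (\<Prod>k<n. I k) mod I n) = f n (q div (\<Prod>k<n. I k) mod I n)"
      using dig by simp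
  next
    fix x q assume "x \<in> {..<I N}" "q \<in> {..<?P}"
    then show "f N ((x * ?P + q) div ?P mod I N) = f N x" using top by simp
  qed
  also have "\<dots> = (\<Prod>n<N. \<Sum>i<I n. f n i) * (\<Sum>x<I N. f N x)"
    by (simp add: Suc[symmetric] sum_distrib_left sum_distrib_right)
  finally show ?case by simp
qed simp

section \<open>Block diagonal matrices and Kronecker products\<close>

lemma blkdiag_0 [simp]: "blkdiag 0 M = 0\<^sub>m 0 0"
  by (simp add: blkdiag_def)

text \<open>The list version unfolds at the front; splitting off the last block instead leaves all
  earlier offsets unchanged, as induction on \<open>N\<close> requires.\<close>

lemma blkdiag_Suc:
  "blkdiag (Suc N) M = four_block_mat (blkdiag N M) (0\<^sub>m (dim_row (blkdiag N M)) (dim_col (M N)))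
     (0\<^sub>m (dim_row (M N)) (dim_col (blkdiag N M))) (M N)"
  by (simp add: blkdiag_def diag_block_mat_last Let_def)

lemma blkdiag_carrier:
  assumes "\<And>n. n < N \<Longrightarrow> M n \<in> carrier_mat (d n) (e n)"
  shows "blkdiag N M \<in> carrier_mat (\<Sum>n<N. d n) (\<Sum>n<N. e n)"
  using assms
proof (induction N)
  case (Suc N)
  have "blkdiag N M \<in> carrier_mat (\<Sum>n<N. d n) (\<Sum>n<N. e n)" using Suc by simp
  moreover have "M N \<in> carrier_mat (d N) (e N)" using Suc.prems by simp
  ultimately show ?case by (simp add: blkdiag_Suc)
qed auto

lemma blkdiag_cong: "(\<And>n. n < N \<Longrightarrow> M n = M' n) \<Longrightarrow> blkdiag N M = blkdiag N M'"
  unfolding blkdiag_def by (intro arg_cong[of _ _ diag_block_mat] map_cong) auto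

lemma blkdiag_index:
  assumes "\<And>n. n < N \<Longrightarrow> M n \<in> carrier_mat (d n) (e n)"
    and "n < N" "i < d n" "m < N" "j < e m"
  shows "blkdiag N M $$ ((\<Sum>k<n. d k) + i, (\<Sum>k<m. e k) + j) = (if n = m then M n $$ (i, j) else 0)"
  using assms
proof (induction N)
  case (Suc N)
  have B: "blkdiag N M \<in> carrier_mat (\<Sum>n<N. d n) (\<Sum>n<N. e n)"
    using blkdiag_carrier Suc.prems(1) by simp
  have M: "M N \<in> carrier_mat (d N) (e N)" using Suc.prems by simp
  \<comment> \<open>One case for each quadrant of the four-block form; the last is the newly added
    block.\<close>
  consider "n < N" "m < N" | "n < N" "m = N" | "n = N" "m < N" | "n = N" "m = N"
    using Suc.prems by linarith
  then show ?case
  proof cases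
    case 1
    then show ?thesis
      using Suc.IH Suc.prems B M block_index_less[of n N i d] block_index_less[of m N j e]
      by (simp add: blkdiag_Suc)
  next
    case 2
    then show ?thesis
      using Suc.prems(2-) B M block_index_less[of n N i d] by (simp add: blkdiag_Suc)
  next
    case 3
    then show ?thesis
      using Suc.prems(2-) B M block_index_less[of m N j e] by (simp add: blkdiag_Suc)
  next
    case 4
    then show ?thesis using Suc.prems(2-) B M by (simp add: blkdiag_Suc)
  qed
qed simp

lemma blkdiag_transpose:
  assumes "\<And>n. n < N \<Longrightarrow> M n \<in> carrier_mat (d n) (e n)"
  shows "(blkdiag N M)\<^sup>T = blkdiag N (\<lambda>n. (M n)\<^sup>T)"
  using assms
proof (induction N)
  case (Suc N)
  have B: "blkdiag N M \<in> carrier_mat (\<Sum>n<N. d n) (\<Sum>n<N. e n)"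
    using blkdiag_carrier Suc.prems(1) by simp
  have M: "M N \<in> carrier_mat (d N) (e N)" using Suc.prems by simp
  have IH: "(blkdiag N M)\<^sup>T = blkdiag N (\<lambda>n. (M n)\<^sup>T)" using Suc by simp
  have z: "(0\<^sub>m a b)\<^sup>T = (0\<^sub>m b a :: real mat)" for a b by auto
  show ?case unfolding blkdiag_Suc
    by (subst transpose_four_block_mat[OF B _ _ M])
      (use B M in \<open>auto simp: IH[symmetric] z\<close>)
qed auto

lemma blkdiag_mult:
  assumes "\<And>n. n < N \<Longrightarrow> X n \<in> carrier_mat (d n) (e n)" "\<And>n. n < N \<Longrightarrow> Y n \<in> carrier_mat (e n) (f n)"
  shows "blkdiag N X * blkdiag N Y = blkdiag N (\<lambda>n. X n * Y n)"
  using assms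
proof (induction N)
  case (Suc N)
  have BX: "blkdiag N X \<in> carrier_mat (\<Sum>n<N. d n) (\<Sum>n<N. e n)"
    using blkdiag_carrier Suc.prems(1) by simp
  have BY: "blkdiag N Y \<in> carrier_mat (\<Sum>n<N. e n) (\<Sum>n<N. f n)"
    using blkdiag_carrier Suc.prems(2) by simp
  have X: "X N \<in> carrier_mat (d N) (e N)" and Y: "Y N \<in> carrier_mat (e N) (f N)"
    using Suc.prems by simp_all
  have IH: "blkdiag N X * blkdiag N Y = blkdiag N (\<lambda>n. X n * Y n)" using Suc by simp
  have BXY: "blkdiag N (\<lambda>n. X n * Y n) \<in> carrier_mat (\<Sum>n<N. d n) (\<Sum>n<N. f n)"
    using BX BY IH by (metis mult_carrier_mat)
  show ?case unfolding blkdiag_Suc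
    apply (subst mult_four_block_mat[where ?nr1.0 = "\<Sum>n<N. d n" and ?n1.0 = "\<Sum>n<N. e n"
        and ?n2.0 = "e N" and ?nr2.0 = "d N" and ?nc1.0 = "\<Sum>n<N. f n" and ?nc2.0 = "f N"])
    using BX BY X Y BXY by (auto simp: IH)
qed auto

lemma blkdiag_one: "blkdiag N (\<lambda>n. 1\<^sub>m (d n)) = 1\<^sub>m (\<Sum>n<N. d n)"
proof (induction N)
  case (Suc N)
  then show ?case by (simp add: blkdiag_Suc)
qed auto

section \<open>Entries of products with a block diagonal factor\<close>

lemma index_mult_mat_sum:
  assumes "X \<in> carrier_mat a b" "Y \<in> carrier_mat b c" "i < a" "j < c"
  shows "(X * Y) $$ (i, j) = (\<Sum>k<b. X $$ (i, k) * Y $$ (k, j))"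
  using assms by (auto simp: scalar_prod_def atLeast0LessThan intro!: sum.cong)

text \<open>A row belonging to block \<open>n\<close> vanishes outside the columns of that block, so
  only one term survives in the sum over blocks.\<close>

lemma blkdiag_mult_left_index:
  assumes M: "\<And>n. n < N \<Longrightarrow> M n \<in> carrier_mat (d n) (e n)"
    and X: "X \<in> carrier_mat (\<Sum>n<N. e n) c" and "n < N" "i < d n" "j < c"
  shows "(blkdiag N M * X) $$ ((\<Sum>k<n. d k) + i, j) =
    (\<Sum>u<e n. M n $$ (i, u) * X $$ ((\<Sum>k<n. e k) + u, j))"
proof -
  have "(blkdiag N M * X) $$ ((\<Sum>k<n. d k) + i, j) =
      (\<Sum>m<N. \<Sum>u<e m. blkdiag N M $$ ((\<Sum>k<n. d k) + i, (\<Sum>k<m. e k) + u) * X $$ ((\<Sum>k<m. e k) + u, j))"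
    using assms block_index_less[of n N i d]
    by (subst index_mult_mat_sum[OF blkdiag_carrier X]) (auto simp: sum_less_blocks)
  also have "\<dots> = (\<Sum>m<N. \<Sum>u<e m. (if n = m then M n $$ (i, u) * X $$ ((\<Sum>k<n. e k) + u, j) else 0))"
    using assms by (intro sum.cong refl) (simp add: blkdiag_index[OF M])
  also have "\<dots> = (\<Sum>m<N. if n = m then \<Sum>u<e n. M n $$ (i, u) * X $$ ((\<Sum>k<n. e k) + u, j) else 0)"
    by (intro sum.cong refl) auto
  finally show ?thesis using assms by simp
qed

lemma blkdiag_mult_right_index:
  assumes M: "\<And>n. n < N \<Longrightarrow> M n \<in> carrier_mat (d n) (e n)"
    and X: "X \<in> carrier_mat c (\<Sum>n<N. d n)" and "n < N" "i < e n" "j < c"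
  shows "(X * blkdiag N M) $$ (j, (\<Sum>k<n. e k) + i) =
    (\<Sum>u<d n. X $$ (j, (\<Sum>k<n. d k) + u) * M n $$ (u, i))"
proof -
  have "(X * blkdiag N M) $$ (j, (\<Sum>k<n. e k) + i) =
      (\<Sum>m<N. \<Sum>u<d m. X $$ (j, (\<Sum>k<m. d k) + u) * blkdiag N M $$ ((\<Sum>k<m. d k) + u, (\<Sum>k<n. e k) + i))"
    using assms block_index_less[of n N i e]
    by (subst index_mult_mat_sum[OF X blkdiag_carrier]) (auto simp: sum_less_blocks)
  also have "\<dots> = (\<Sum>m<N. \<Sum>u<d m. (if n = m then X $$ (j, (\<Sum>k<n. d k) + u) * M n $$ (u, i) else 0))"
    using assms by (intro sum.cong refl) (auto simp: blkdiag_index[OF M])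
  also have "\<dots> = (\<Sum>m<N. if n = m then \<Sum>u<d n. X $$ (j, (\<Sum>k<n. d k) + u) * M n $$ (u, i) else 0)"
    by (intro sum.cong refl) auto
  finally show ?thesis using assms by simp
qed

section \<open>Kronecker products in pair-index form\<close>

lemma kron_carrier:
  "X \<in> carrier_mat a b \<Longrightarrow> Y \<in> carrier_mat c d \<Longrightarrow> kron X Y \<in> carrier_mat (a * c) (b * d)"
  by (auto simp: kron_def)

lemma kron_index:
  assumes "X \<in> carrier_mat a b" "Y \<in> carrier_mat c d" "r < a" "i < c" "s < b" "j < d"
  shows "kron X Y $$ (r * c + i, s * d + j) = X $$ (r, s) * Y $$ (i, j)"
  using assms prod_index_less[of r a i c] prod_index_less[of s b j d] by (auto simp: kron_def)

lemma eq_mat_prod_indexI: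
  assumes "X \<in> carrier_mat (a * c) (b * d)" "Y \<in> carrier_mat (a * c) (b * d)"
    and "\<And>r i s j. r < a \<Longrightarrow> i < c \<Longrightarrow> s < b \<Longrightarrow> j < d \<Longrightarrow>
      X $$ (r * c + i, s * d + j) = Y $$ (r * c + i, s * d + j)"
  shows "X = Y"
proof (rule eq_matI)
  fix p q assume "p < dim_row Y" "q < dim_col Y"
  then have "p < a * c" "q < b * d" using assms by auto
  then show "X $$ (p, q) = Y $$ (p, q)" by (elim prod_index_cases) (simp add: assms(3))
qed (use assms in auto)

text \<open>Mixed-product rule: with the inner index written as \<open>u * d + v\<close>, each
  summand is a term in \<open>u\<close> times a term in \<open>v\<close>, so the double sum
  separates into two matrix products.\<close>

lemma kron_mult:
  assumes X: "X \<in> carrier_mat a b" and Y: "Y \<in> carrier_mat c d"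
    and X': "X' \<in> carrier_mat b e" and Y': "Y' \<in> carrier_mat d f"
  shows "kron X Y * kron X' Y' = kron (X * X') (Y * Y')"
proof (rule eq_mat_prod_indexI)
  note C = kron_carrier[OF X Y] kron_carrier[OF X' Y']
  show "kron X Y * kron X' Y' \<in> carrier_mat (a * c) (e * f)" using C by simp
  show "kron (X * X') (Y * Y') \<in> carrier_mat (a * c) (e * f)" using assms by (intro kron_carrier) auto
  fix r i s j assume I: "r < a" "i < c" "s < e" "j < f"
  have "(kron X Y * kron X' Y') $$ (r * c + i, s * f + j) =
      (\<Sum>u<b. \<Sum>v<d. kron X Y $$ (r * c + i, u * d + v) * kron X' Y' $$ (u * d + v, s * f + j))"
    using I by (subst index_mult_mat_sum[OF C]) (auto simp: prod_index_less sum_less_mult)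
  also have "\<dots> = (\<Sum>u<b. \<Sum>v<d. (X $$ (r, u) * X' $$ (u, s)) * (Y $$ (i, v) * Y' $$ (v, j)))"
    using I by (intro sum.cong refl) (simp add: kron_index[OF X Y] kron_index[OF X' Y'])
  also have "\<dots> = (X * X') $$ (r, s) * (Y * Y') $$ (i, j)"
    using I by (simp add: index_mult_mat_sum[OF X X'] index_mult_mat_sum[OF Y Y'] sum_product)
  also have "\<dots> = kron (X * X') (Y * Y') $$ (r * c + i, s * f + j)"
    using I assms by (intro kron_index[symmetric]) auto
  finally show "(kron X Y * kron X' Y') $$ (r * c + i, s * f + j) = kron (X * X') (Y * Y') $$ (r * c + i, s * f + j)" .
qed

lemma kron_transpose:
  assumes X: "X \<in> carrier_mat a b" and Y: "Y \<in> carrier_mat c d"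
  shows "(kron X Y)\<^sup>T = kron X\<^sup>T Y\<^sup>T"
proof (rule eq_mat_prod_indexI)
  show "(kron X Y)\<^sup>T \<in> carrier_mat (b * d) (a * c)" using kron_carrier[OF X Y] by simp
  show "kron X\<^sup>T Y\<^sup>T \<in> carrier_mat (b * d) (a * c)" using X Y by (intro kron_carrier) auto
  fix r i s j assume I: "r < b" "i < d" "s < a" "j < c"
  have "kron X\<^sup>T Y\<^sup>T $$ (r * d + i, s * c + j) = X\<^sup>T $$ (r, s) * Y\<^sup>T $$ (i, j)"
    using X Y I by (intro kron_index) auto
  then show "(kron X Y)\<^sup>T $$ (r * d + i, s * c + j) = kron X\<^sup>T Y\<^sup>T $$ (r * d + i, s * c + j)"
    using X Y I kron_carrier[OF X Y] by (simp add: kron_index[OF X Y] prod_index_less)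
qed

lemma kron_one: "kron (1\<^sub>m a) (1\<^sub>m b) = 1\<^sub>m (a * b)"
proof (rule eq_mat_prod_indexI)
  show "kron (1\<^sub>m a) (1\<^sub>m b) \<in> carrier_mat (a * b) (a * b)" by (intro kron_carrier) auto
  fix r i s j assume I: "r < a" "i < b" "s < a" "j < b"
  have "r * b + i = s * b + j \<longleftrightarrow> r = s \<and> i = j"
    using block_index_eq_iff[of i "\<lambda>_. b" r j s] I by simp
  then show "kron (1\<^sub>m a) (1\<^sub>m b) $$ (r * b + i, s * b + j) = 1\<^sub>m (a * b) $$ (r * b + i, s * b + j)"
    using I by (subst kron_index[of _ a a _ b b]) (auto simp: prod_index_less)
qed simp

section \<open>Inverses\<close>

text \<open>For square matrices over a field a right inverse is two-sided, and inverses are unique.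
  This is how \<open>inverse_mat\<close> is evaluated below: it suffices to exhibit one right
  inverse.\<close>

lemma invertible_matI:
  fixes M :: "real mat"
  assumes M: "M \<in> carrier_mat n n" and X: "X \<in> carrier_mat n n" and MX: "M * X = 1\<^sub>m n"
  shows "invertible_mat M" "inverse_mat M = X"
proof -
  have XM: "X * M = 1\<^sub>m n" using mat_mult_left_right_inverse[OF M X MX] .
  show inv: "invertible_mat M"
    using M X MX XM unfolding invertible_mat_def inverts_mat_def by auto
  note I = inverse_mat_inverts[OF inv M]
  have "inverse_mat M = (inverse_mat M * M) * X"
    using I(1) M X MX by (simp add: assoc_mult_mat[OF I(1) M X])
  then show "inverse_mat M = X" using I(3) X by simp
qed

text \<open>A trivial kernel forces a nonzero determinant, and a matrix with nonzero determinant is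
  a unit of the matrix ring.\<close>

lemma invertible_mat_if_injective:
  fixes M :: "real mat"
  assumes M: "M \<in> carrier_mat n n"
    and inj: "\<And>x. x \<in> carrier_vec n \<Longrightarrow> M *\<^sub>v x = 0\<^sub>v n \<Longrightarrow> x = 0\<^sub>v n"
  shows "invertible_mat M"
proof -
  have "det M \<noteq> 0" using det_0_iff_vec_prod_zero_field[OF M] inj by blast
  then have "M \<in> Units (ring_mat TYPE(real) n ())" by (rule det_non_zero_imp_unit[OF M])
  then obtain X where "X \<in> carrier_mat n n" "M * X = 1\<^sub>m n"
    unfolding Units_def by (auto simp: ring_mat_simps)
  then show ?thesis using invertible_matI[OF M] by blast
qed

lemma invertible_mat_injective:
  fixes M :: "real mat"
  assumes M: "M \<in> carrier_mat n n" and inv: "invertible_mat M"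
    and x: "x \<in> carrier_vec n" and Mx: "M *\<^sub>v x = 0\<^sub>v n"
  shows "x = 0\<^sub>v n"
proof -
  note I = inverse_mat_inverts[OF inv M]
  have "x = inverse_mat M *\<^sub>v (M *\<^sub>v x)"
    using I x by (simp add: assoc_mult_mat_vec[OF I(1) M x, symmetric])
  then show ?thesis using Mx I(1) by auto
qed

text \<open>Transposing \<open>inverse_mat M * M = 1\<^sub>m n\<close> and using the symmetry of
  \<open>M\<close> shows that the transposed inverse is a right inverse too.\<close>

lemma inverse_mat_transpose:
  assumes M: "M \<in> carrier_mat n n" and inv: "invertible_mat M" and sym: "M\<^sup>T = M"
  shows "(inverse_mat M)\<^sup>T = inverse_mat M"
proof -
  note I = inverse_mat_inverts[OF inv M]
  have "M * (inverse_mat M)\<^sup>T = (inverse_mat M * M)\<^sup>T"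
    using transpose_mult[OF I(1) M] sym by simp
  then show ?thesis using I invertible_matI(2)[OF M, of "(inverse_mat M)\<^sup>T"] by simp
qed

section \<open>Positive definiteness of damped Gram matrices, and Woodbury's identity\<close>

lemma scalar_prod_self:
  fixes x :: "real Matrix.vec"
  assumes "x \<in> carrier_vec n"
  shows "x \<bullet> x \<ge> 0" "x \<bullet> x = 0 \<longleftrightarrow> x = 0\<^sub>v n"
proof -
  show "x \<bullet> x \<ge> 0" by (auto simp: scalar_prod_def intro!: sum_nonneg)
  show "x \<bullet> x = 0 \<longleftrightarrow> x = 0\<^sub>v n"
    using assms by (auto simp: scalar_prod_def sum_nonneg_eq_0_iff intro!: eq_vecI)
qed

text \<open>Pairing a kernel vector \<open>x\<close> with its image gives 0 = |F x|^2 +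
  \<open>\<mu>\<close> |x|^2, and since \<open>\<mu> > 0\<close> this forces \<open>x\<close> to
  vanish.\<close>

lemma gram_plus_smult_one_invertible:
  fixes F :: "real mat"
  assumes F: "F \<in> carrier_mat m n" and "\<mu> > 0"
  shows "invertible_mat (F\<^sup>T * F + \<mu> \<cdot>\<^sub>m 1\<^sub>m n)"
proof (rule invertible_mat_if_injective)
  show "F\<^sup>T * F + \<mu> \<cdot>\<^sub>m 1\<^sub>m n \<in> carrier_mat n n" using F by simp
  fix x assume x: "x \<in> carrier_vec n" and 0: "(F\<^sup>T * F + \<mu> \<cdot>\<^sub>m 1\<^sub>m n) *\<^sub>v x = 0\<^sub>v n"
  have FT: "F\<^sup>T \<in> carrier_mat n m" and Fx: "F *\<^sub>v x \<in> carrier_vec m" using F x by auto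
  have "(F\<^sup>T * F + \<mu> \<cdot>\<^sub>m 1\<^sub>m n) *\<^sub>v x = F\<^sup>T *\<^sub>v (F *\<^sub>v x) + \<mu> \<cdot>\<^sub>v x"
  proof -
    have "(\<mu> \<cdot>\<^sub>m 1\<^sub>m n) *\<^sub>v x = \<mu> \<cdot>\<^sub>v x"
      using x by (intro eq_vecI) auto
    then show ?thesis using F FT x
      by (simp add: add_mult_distrib_mat_vec[of _ n n] assoc_mult_mat_vec[OF FT F x])
  qed
  with 0 have "F\<^sup>T *\<^sub>v (F *\<^sub>v x) + \<mu> \<cdot>\<^sub>v x = 0\<^sub>v n" by simp
  then have "0 = x \<bullet> (F\<^sup>T *\<^sub>v (F *\<^sub>v x) + \<mu> \<cdot>\<^sub>v x)"
    using x by simp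
  also have "\<dots> = x \<bullet> (F\<^sup>T *\<^sub>v (F *\<^sub>v x)) + \<mu> * (x \<bullet> x)"
    using x FT Fx by (subst scalar_prod_add_distrib[of _ n]) auto
  also have "x \<bullet> (F\<^sup>T *\<^sub>v (F *\<^sub>v x)) = (F *\<^sub>v x) \<bullet> (F *\<^sub>v x)"
    using transpose_vec_mult_scalar[OF FT Fx x] F x FT Fx
    by (metis comm_scalar_prod mult_mat_vec_carrier transpose_transpose)
  finally have "\<mu> * (x \<bullet> x) \<le> 0" using scalar_prod_self(1)[OF Fx] by linarith
  then have "x \<bullet> x = 0" using \<open>\<mu> > 0\<close> scalar_prod_self(1)[OF x] by (simp add: mult_le_0_iff)
  then show "x = 0\<^sub>v n" using scalar_prod_self(2)[OF x] by simp
qed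

text \<open>The middle factor is \<open>K * inverse_mat (1\<^sub>m k + P * K)\<close>, a form that
  also covers singular \<open>K\<close>. Invertibility of the small matrix is inherited from the
  large one, by turning kernel vectors of the former into kernel vectors of the latter. The formula
  is then verified by exhibiting a right inverse.\<close>

lemma woodbury:
  fixes Dm G Z K P :: "real mat"
  assumes Dm: "Dm \<in> carrier_mat n n" and G: "G \<in> carrier_mat n n" and Z: "Z \<in> carrier_mat n k"
    and K: "K \<in> carrier_mat k k" and DG: "Dm * G = 1\<^sub>m n"
    and inv: "invertible_mat (Dm + Z * K * Z\<^sup>T)"
  defines "P \<equiv> Z\<^sup>T * G * Z"
  shows "invertible_mat (1\<^sub>m k + P * K)"
    "inverse_mat (Dm + Z * K * Z\<^sup>T) =
      G - (G * Z) * (K * inverse_mat (1\<^sub>m k + P * K)) * (Z\<^sup>T * G)"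
proof -
  have ZT: "Z\<^sup>T \<in> carrier_mat k n" using Z by simp
  have P: "P \<in> carrier_mat k k" using Z G by (simp add: P_def)
  have GD: "G * Dm = 1\<^sub>m n" using mat_mult_left_right_inverse[OF Dm G DG] .
  define M where "M = Dm + Z * K * Z\<^sup>T"
  have M: "M \<in> carrier_mat n n" using Dm Z K by (simp add: M_def)
  show inv1: "invertible_mat (1\<^sub>m k + P * K)"
  proof (rule invertible_mat_if_injective)
    show "1\<^sub>m k + P * K \<in> carrier_mat k k" using P K by simp
    fix x assume x: "x \<in> carrier_vec k" and 0: "(1\<^sub>m k + P * K) *\<^sub>v x = 0\<^sub>v k"
    \<comment> \<open>The vector \<open>y\<close> is chosen so that \<open>Dm\<close> maps it to
      \<open>w\<close>, while its image under the transpose of \<open>Z\<close> is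
      \<open>P *\<^sub>v (K *\<^sub>v x)\<close>, which equals \<open>- x\<close>. The two terms of
      \<open>M *\<^sub>v y\<close> are then \<open>w\<close> and \<open>- w\<close>.\<close>
    define w where "w = Z *\<^sub>v (K *\<^sub>v x)"
    define y where "y = G *\<^sub>v w"
    have Kx: "K *\<^sub>v x \<in> carrier_vec k" using K x by simp
    have w: "w \<in> carrier_vec n" using Z Kx by (simp add: w_def)
    have y: "y \<in> carrier_vec n" using G w by (simp add: y_def)
    have ZTy: "Z\<^sup>T *\<^sub>v y \<in> carrier_vec k" using ZT y by simp
    have "(1\<^sub>m k + P * K) *\<^sub>v x = x + P *\<^sub>v (K *\<^sub>v x)"
      using P K x by (simp add: add_mult_distrib_mat_vec[of _ k k] assoc_mult_mat_vec[OF P K x])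
    also have "P *\<^sub>v (K *\<^sub>v x) = Z\<^sup>T *\<^sub>v y"
      using ZT G Z Kx w unfolding P_def y_def w_def
      by (simp add: assoc_mult_mat_vec[of _ k n _ k] assoc_mult_mat_vec[of _ k n _ n])
    finally have xy: "x + Z\<^sup>T *\<^sub>v y = 0\<^sub>v k" using 0 by simp
    have xZ: "Z\<^sup>T *\<^sub>v y = - x"
    proof (rule eq_vecI)
      fix i assume "i < dim_vec (- x)"
      then have i: "i < k" using x by simp
      have "(x + Z\<^sup>T *\<^sub>v y) $ i = x $ i + (Z\<^sup>T *\<^sub>v y) $ i"
        using i Z by (intro index_add_vec) simp
      then show "(Z\<^sup>T *\<^sub>v y) $ i = (- x) $ i" using xy i x by simp
    qed (use x Z in simp)
    have Dy: "Dm *\<^sub>v y = w"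
      using Dm G w DG unfolding y_def by (simp add: assoc_mult_mat_vec[OF Dm G w, symmetric])
    have "M *\<^sub>v y = Dm *\<^sub>v y + Z *\<^sub>v (K *\<^sub>v (Z\<^sup>T *\<^sub>v y))"
      using Dm Z K ZT y ZTy unfolding M_def
      by (simp add: add_mult_distrib_mat_vec[of _ n n] assoc_mult_mat_vec[of _ n k _ n]
          assoc_mult_mat_vec[of _ n k _ k])
    also have "\<dots> = w + - w"
    proof -
      have neg: "X *\<^sub>v (- v) = - (X *\<^sub>v v)" if "X \<in> carrier_mat a b" "v \<in> carrier_vec b" for X :: "real mat" and v a b
        using that by (intro eq_vecI) auto
      show ?thesis unfolding xZ Dy neg[OF K x] neg[OF Z Kx] by (simp add: w_def)
    qed
    also have "\<dots> = 0\<^sub>v n" using w by auto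
    finally have "y = 0\<^sub>v n"
      using invertible_mat_injective[OF M _ y] inv by (simp add: M_def)
    moreover have "Z\<^sup>T *\<^sub>v 0\<^sub>v n = 0\<^sub>v k" using Z by (intro eq_vecI) auto
    ultimately have "- x = 0\<^sub>v k" using xZ by simp
    then show "x = 0\<^sub>v k" using x by (metis uminus_zero_vec_eq)
  qed
  define S where "S = inverse_mat (1\<^sub>m k + P * K)"
  define B where "B = K * S"
  have PK: "1\<^sub>m k + P * K \<in> carrier_mat k k" using P K by simp
  note I = inverse_mat_inverts[OF inv1 PK, folded S_def]
  have B: "B \<in> carrier_mat k k" using I(1) K by (simp add: B_def)
  \<comment> \<open>This is the defining equation of the inverse \<open>S\<close> multiplied from
    the left by \<open>K\<close>. It is what makes the correction term cancel below.\<close>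
  have KB: "K = B + K * (P * B)"
  proof -
    have "K = K * ((1\<^sub>m k + P * K) * S)" using K I by simp
    also have "(1\<^sub>m k + P * K) * S = S + P * B"
      using P K I(1) unfolding B_def
      by (simp add: add_mult_distrib_mat[of _ k k] assoc_mult_mat[of _ k k _ k])
    also have "K * (S + P * B) = B + K * (P * B)"
      unfolding B_def using P K I(1) B by (simp add: mult_add_distrib_mat[of _ k k])
    finally show ?thesis .
  qed
  define W where "W = Z\<^sup>T * G"
  have W: "W \<in> carrier_mat k n" using ZT G by (simp add: W_def)
  have WZ: "W * Z = P" by (simp add: W_def P_def)
  have BW: "B * W \<in> carrier_mat k n" using B W by simp
  have ZBW: "Z * (B * W) \<in> carrier_mat n n" using Z BW by simp
  have e1: "Dm * ((G * Z) * B * W) = Z * (B * W)"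
  proof -
    have "Dm * ((G * Z) * B * W) = (Dm * G) * (Z * (B * W))"
      using Dm G Z B W BW ZBW
      by (simp add: assoc_mult_mat[OF Dm G ZBW] assoc_mult_mat[of _ n k _ k] assoc_mult_mat[of _ n n _ n] assoc_mult_mat[of _ n n _ k]
          assoc_mult_mat[of _ n k _ n])
    then show ?thesis using DG left_mult_one_mat[OF ZBW] by simp
  qed
  have e2: "(Z * K * Z\<^sup>T) * ((G * Z) * B * W) = Z * (K * (P * B) * W)"
  proof -
    have GZ: "G * Z \<in> carrier_mat n k" and GZB: "G * Z * B \<in> carrier_mat n k"
      and GZBW: "G * Z * B * W \<in> carrier_mat n n" and ZK: "Z * K \<in> carrier_mat n k"
      and PB: "P * B \<in> carrier_mat k k"
      using G Z K B W P by auto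
    have "Z\<^sup>T * (G * Z * B * W) = P * B * W"
      using assoc_mult_mat[OF ZT GZB W] assoc_mult_mat[OF ZT GZ B] assoc_mult_mat[OF ZT G Z]
      by (simp add: P_def)
    then show ?thesis
      using assoc_mult_mat[OF ZK ZT GZBW] assoc_mult_mat[OF Z K mult_carrier_mat[OF ZT GZBW]]
        assoc_mult_mat[OF K PB W] by simp
  qed
  have e3: "(Z * K * Z\<^sup>T) * G = Z * (K * W)"
    unfolding W_def using Z K ZT G
    by (simp add: assoc_mult_mat[of _ n k _ n] assoc_mult_mat[of _ n k _ k] assoc_mult_mat[of _ k k _ n] assoc_mult_mat[of _ k n _ n])
  define U where "U = (G * Z) * B * W"
  have U: "U \<in> carrier_mat n n"
    unfolding U_def by (rule mult_carrier_mat[OF mult_carrier_mat[OF mult_carrier_mat[OF G Z] B] W])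
  have KPB: "K * (P * B) \<in> carrier_mat k k" using K P B by simp
  \<comment> \<open>\<open>V\<close> is \<open>M * U\<close> expanded. By \<open>KB\<close> it also
    equals \<open>Z * (K * W)\<close>, the excess of \<open>M * G\<close> over the identity, so
    \<open>G - U\<close> is a right inverse of \<open>M\<close>.\<close>
  define V where "V = Z * (B * W) + Z * (K * (P * B) * W)"
  have V: "V \<in> carrier_mat n n"
    unfolding V_def using Z KPB W by (intro add_carrier_mat mult_carrier_mat[OF Z]) simp
  have ZKZT: "Z * K * Z\<^sup>T \<in> carrier_mat n n"
    by (rule mult_carrier_mat[OF mult_carrier_mat[OF Z K] ZT])
  have MG: "M * G = 1\<^sub>m n + V"
  proof -
    have "K * W = B * W + K * (P * B) * W"
      using add_mult_distrib_mat[OF B KPB W] by (simp only: KB[symmetric])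
    then have "Z * (K * W) = V"
      unfolding V_def using Z BW mult_carrier_mat[OF KPB W] by (simp only: mult_add_distrib_mat)
    then show ?thesis
      unfolding M_def by (simp only: add_mult_distrib_mat[OF Dm ZKZT G] DG e3)
  qed
  have MU: "M * U = V"
    unfolding M_def add_mult_distrib_mat[OF Dm ZKZT U] V_def by (simp only: U_def e1 e2)
  have "M * (G - U) = 1\<^sub>m n + V - V"
    unfolding mult_minus_distrib_mat[OF M G U] MG MU ..
  also have "\<dots> = 1\<^sub>m n" using V by (intro eq_matI) auto
  finally have "M * (G - U) = 1\<^sub>m n" .
  moreover have "G - U \<in> carrier_mat n n" using U by (rule minus_carrier_mat)
  ultimately have "inverse_mat M = G - U" using invertible_matI(2)[OF M] by blast
  then show "inverse_mat (Dm + Z * K * Z\<^sup>T) =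
      G - (G * Z) * (K * inverse_mat (1\<^sub>m k + P * K)) * (Z\<^sup>T * G)"
    unfolding M_def U_def B_def S_def W_def .
qed

text \<open>Since \<open>(inverse_mat K + P) * K = 1\<^sub>m k + P * K\<close>, the two expressions
  for the middle factor agree when \<open>K\<close> is invertible. The case distinction in
  \<open>B\<close> thereby reduces to a single formula.\<close>

lemma inverse_inverse_mat_add:
  assumes K: "K \<in> carrier_mat k k" and P: "P \<in> carrier_mat k k"
    and Kinv: "invertible_mat K" and inv: "invertible_mat (1\<^sub>m k + P * K)"
  shows "invertible_mat (inverse_mat K + P)"
    "inverse_mat (inverse_mat K + P) = K * inverse_mat (1\<^sub>m k + P * K)"
proof -
  note I = inverse_mat_inverts[OF Kinv K]
  have C: "1\<^sub>m k + P * K \<in> carrier_mat k k" using P K by simp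
  note J = inverse_mat_inverts[OF inv C]
  have IP: "inverse_mat K + P \<in> carrier_mat k k" using I P by simp
  have "(inverse_mat K + P) * (K * inverse_mat (1\<^sub>m k + P * K)) =
      ((inverse_mat K + P) * K) * inverse_mat (1\<^sub>m k + P * K)"
    using assoc_mult_mat[OF IP K J(1)] by simp
  also have "(inverse_mat K + P) * K = 1\<^sub>m k + P * K"
    using I K P by (simp add: add_mult_distrib_mat[of _ k k])
  finally have *: "(inverse_mat K + P) * (K * inverse_mat (1\<^sub>m k + P * K)) = 1\<^sub>m k"
    using J by simp
  show "invertible_mat (inverse_mat K + P)"
    "inverse_mat (inverse_mat K + P) = K * inverse_mat (1\<^sub>m k + P * K)"
    using invertible_matI[OF IP _ *] K J(1) by auto
qed

section \<open>The Jacobian and the Gram matrix of the CP model\<close>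

lemma cp_params_dim:
  assumes "\<And>k. k < N \<Longrightarrow> A k \<in> carrier_mat (I k) R"
  shows "dim_vec (cp_params N A) = (\<Sum>k<N. R * I k)"
proof -
  have "dim_vec (cp_params N A) = (\<Sum>k<N. dim_vec (vec_of_mat (A k)))"
    by (simp add: cp_params_def length_concat comp_def interv_sum_list_conv_sum_set_nat atLeast0LessThan)
  also have "\<dots> = (\<Sum>k<N. R * I k)"
  proof (intro sum.cong refl)
    fix k assume "k \<in> {..<N}"
    then show "dim_vec (vec_of_mat (A k)) = R * I k" using assms[of k] by (simp add: vec_of_mat_def)
  qed
  finally show ?thesis .
qed

text \<open>Column stacking puts entry \<open>(i, r)\<close> of factor \<open>n\<close> at position
  \<open>r * I n + i\<close> of block \<open>n\<close>, which is also the row index of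
  \<open>kron (1\<^sub>m R) (A n)\<close> for the pair \<open>r\<close>, \<open>i\<close>. As such
  positions are unique, changing one coordinate changes exactly one entry of one factor.\<close>

lemma cp_factors_update_index:
  assumes a: "dim_vec a = (\<Sum>k<N. R * I k)"
    and "n < N" "i < I n" "r < R" "k < N" "x < I k" "s < R"
  shows "cp_factors I R (a |\<^sub>v (\<Sum>k<n. R * I k) + (r * I n + i) \<mapsto> t) k $$ (x, s) =
    (if k = n \<and> x = i \<and> s = r then t else cp_factors I R a k $$ (x, s))"
proof -
  let ?o = "\<lambda>n. \<Sum>k<n. R * I k"
  have "s * I k + x < R * I k" "r * I n + i < R * I n"
    using assms by (simp_all add: prod_index_less)
  then have "?o k + (s * I k + x) < (\<Sum>k<N. R * I k)" "?o n + (r * I n + i) < (\<Sum>k<N. R * I k)"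
    and "?o k + (s * I k + x) = ?o n + (r * I n + i) \<longleftrightarrow> k = n \<and> s * I k + x = r * I n + i"
    using assms by (auto intro!: block_index_less simp: block_index_eq_iff)
  moreover have "k = n \<and> s * I k + x = r * I n + i \<longleftrightarrow> k = n \<and> x = i \<and> s = r"
    using assms block_index_eq_iff[of x "\<lambda>_. I n" s i r] by auto
  ultimately show ?thesis
    using assms by (simp add: cp_factors_def mult.commute[of "I _" R] add.assoc)
qed

text \<open>The model is multilinear: the parameter at \<open>(i, r)\<close> of factor
  \<open>n\<close> enters only the \<open>r\<close>-th rank-one term, and there linearly.
  Differentiation thus replaces column \<open>r\<close> of factor \<open>n\<close> by a unit vector.
  The result is written as a product over all modes to match \<open>sum_mixed_radix\<close>.\<close>

lemma cp_model_jacobian_index: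
  assumes A: "\<And>k. k < N \<Longrightarrow> A k \<in> carrier_mat (I k) R"
    and p: "p < (\<Prod>k<N. I k)" and n: "n < N" and i: "i < I n" and r: "r < R"
  shows "jacobian (cp_model N I R) (cp_params N A) $$ (p, (\<Sum>k<n. R * I k) + (r * I n + i)) =
    (\<Prod>k<N. let x = p div (\<Prod>l<k. I l) mod I k in
       if k = n then of_bool (x = i) else A k $$ (x, r))"
proof -
  let ?a = "cp_params N A" and ?j = "(\<Sum>k<n. R * I k) + (r * I n + i)"
  let ?d = "\<lambda>k. p div (\<Prod>l<k. I l) mod I k"
  \<comment> \<open>The existence of an index \<open>p\<close> excludes empty modes, so every digit
    is a legal row index.\<close>
  have "I k > 0" if "k < N" for k
    using p that by (metis finite_lessThan lessThan_iff less_nat_zero_code neq0_conv prod_zero_iff)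
  then have d: "?d k < I k" if "k < N" for k using that by simp
  have a: "dim_vec ?a = (\<Sum>k<N. R * I k)" using A by (rule cp_params_dim)
  have j: "?j < dim_vec ?a"
    unfolding a using n i r by (intro block_index_less) (auto simp: prod_index_less)
  have rest: "(\<Prod>k<N. f k) = f n * (\<Prod>k\<in>{..<N} - {n}. f k)" for f :: "nat \<Rightarrow> real"
    using n by (simp add: prod.remove)
  \<comment> \<open>The varied coordinate appears only in the mode-\<open>n\<close> factor.
    Isolating that factor leaves coefficients independent of \<open>t\<close>, so the derivative can
    be read off term by term.\<close>
  have model: "cp_model N I R (?a |\<^sub>v ?j \<mapsto> t) $ p =
      (\<Sum>s<R. (if ?d n = i \<and> s = r then t else A n $$ (?d n, s)) *
         (\<Prod>k\<in>{..<N} - {n}. A k $$ (?d k, s)))" for t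
  proof -
    have "cp_model N I R (?a |\<^sub>v ?j \<mapsto> t) $ p =
        (\<Sum>s<R. \<Prod>k<N. col (cp_factors I R (?a |\<^sub>v ?j \<mapsto> t) k) s $ ?d k)"
      using p by (simp add: cp_model_def tensor_vec_def cp_tensor_def outer_def)
    also have "\<dots> = (\<Sum>s<R. \<Prod>k<N. if k = n \<and> ?d k = i \<and> s = r then t else A k $$ (?d k, s))"
    proof (intro sum.cong prod.cong refl)
      fix s k assume "s \<in> {..<R}" "k \<in> {..<N}"
      then have sk: "s < R" "k < N" by simp_all
      have "col (cp_factors I R (?a |\<^sub>v ?j \<mapsto> t) k) s $ ?d k = cp_factors I R (?a |\<^sub>v ?j \<mapsto> t) k $$ (?d k, s)"
        using sk d by (intro index_col) (auto simp: cp_factors_def)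
      then show "col (cp_factors I R (?a |\<^sub>v ?j \<mapsto> t) k) s $ ?d k =
          (if k = n \<and> ?d k = i \<and> s = r then t else A k $$ (?d k, s))"
        by (simp only: cp_factors_update_index[OF a n i r sk(2) d[OF sk(2)] sk(1)]
            cp_factors_cp_params[OF A sk(2)])
    qed
    also have "\<dots> = (\<Sum>s<R. (if ?d n = i \<and> s = r then t else A n $$ (?d n, s)) *
         (\<Prod>k\<in>{..<N} - {n}. A k $$ (?d k, s)))"
      by (intro sum.cong refl) (simp only: rest, auto intro!: prod.cong)
    finally show ?thesis .
  qed
  have "((\<lambda>t. cp_model N I R (?a |\<^sub>v ?j \<mapsto> t) $ p) has_real_derivative
      (\<Sum>s<R. (if ?d n = i \<and> s = r then 1 else 0) * (\<Prod>k\<in>{..<N} - {n}. A k $$ (?d k, s)))) (at t)" for t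
    unfolding model
  proof (intro DERIV_sum DERIV_cmult_right)
    fix s
    show "((\<lambda>t. if ?d n = i \<and> s = r then t else A n $$ (?d n, s)) has_real_derivative
        (if ?d n = i \<and> s = r then 1 else 0)) (at t)"
      by (cases "?d n = i \<and> s = r") auto
  qed
  then have "deriv (\<lambda>t. cp_model N I R (?a |\<^sub>v ?j \<mapsto> t) $ p) (?a $ ?j) =
      (\<Sum>s<R. (if ?d n = i \<and> s = r then 1 else 0) * (\<Prod>k\<in>{..<N} - {n}. A k $$ (?d k, s)))"
    by (rule DERIV_imp_deriv)
  also have "\<dots> = (\<Sum>s<R. if s = r then of_bool (?d n = i) * (\<Prod>k\<in>{..<N} - {n}. A k $$ (?d k, r)) else 0)"
    by (intro sum.cong refl) auto
  also have "\<dots> = of_bool (?d n = i) * (\<Prod>k\<in>{..<N} - {n}. A k $$ (?d k, r))"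
    using r by simp
  also have "\<dots> = (\<Prod>k<N. let x = ?d k in if k = n then of_bool (x = i) else A k $$ (x, r))"
    unfolding rest Let_def by (auto intro!: prod.cong)
  finally show ?thesis
    using p j by (simp add: jacobian_def cp_model_def tensor_vec_def)
qed

lemma cp_model_jacobian_carrier:
  assumes "\<And>k. k < N \<Longrightarrow> A k \<in> carrier_mat (I k) R"
  shows "jacobian (cp_model N I R) (cp_params N A) \<in> carrier_mat (\<Prod>k<N. I k) (\<Sum>k<N. R * I k)"
  using cp_params_dim[of N A I R] assms by (auto simp: jacobian_def cp_model_def tensor_vec_def)

section \<open>Entries of the approximate Hessian, and Gram structure of Hadamard products\<close>

lemma gram_index:
  assumes "F \<in> carrier_mat m n" "i < n" "j < n"
  shows "(F\<^sup>T * F) $$ (i, j) = (\<Sum>k<m. F $$ (k, i) * F $$ (k, j))"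
  using assms by (subst index_mult_mat_sum[of _ n m _ n]) (auto intro!: sum.cong)

text \<open>Both Jacobian columns are products over modes, so their inner product factors. Modes
  other than \<open>n\<close> and \<open>m\<close> contribute entries of \<open>C\<close>. For
  \<open>n \<noteq> m\<close> the unit vector in one column picks an entry of the other column's
  factor, so \<open>r\<close> and \<open>s\<close> appear crossed; this crossing is the source of
  the permutation \<open>comm_mat R\<close> in \<open>K\<close>.\<close>

lemma cp_model_gram_index:
  fixes A :: "nat \<Rightarrow> real mat"
  assumes A: "\<And>k. k < N \<Longrightarrow> A k \<in> carrier_mat (I k) R"
    and n: "n < N" and i: "i < I n" and r: "r < R" and m: "m < N" and j: "j < I m" and s: "s < R"
  defines "J \<equiv> jacobian (cp_model N I R) (cp_params N A)"
    and "C \<equiv> \<lambda>n. (A n)\<^sup>T * A n"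
  shows "(J\<^sup>T * J) $$ ((\<Sum>k<n. R * I k) + (r * I n + i), (\<Sum>k<m. R * I k) + (s * I m + j)) =
    (if n = m then of_bool (i = j) else A n $$ (i, s) * A m $$ (j, r)) *
    hadamard_prod R ({..<N} - {n, m}) C $$ (r, s)"
proof -
  let ?d = "\<lambda>p k. p div (\<Prod>l<k. I l) mod I k"
  define f where "f = (\<lambda>n i (r :: nat) k x. if k = n then of_bool (x = i) else A k $$ (x, r))"
  define g where "g = (\<lambda>k. \<Sum>x<I k. f n i r k x * f m j s k x)"
  have J: "J \<in> carrier_mat (\<Prod>k<N. I k) (\<Sum>k<N. R * I k)"
    unfolding J_def using A by (rule cp_model_jacobian_carrier)
  have idx: "(\<Sum>k<n. R * I k) + (r * I n + i) < (\<Sum>k<N. R * I k)" 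
    "(\<Sum>k<m. R * I k) + (s * I m + j) < (\<Sum>k<N. R * I k)"
    using assms by (auto intro!: block_index_less prod_index_less)
  have "(J\<^sup>T * J) $$ ((\<Sum>k<n. R * I k) + (r * I n + i), (\<Sum>k<m. R * I k) + (s * I m + j)) =
      (\<Sum>p<(\<Prod>k<N. I k). (\<Prod>k<N. f n i r k (?d p k)) * (\<Prod>k<N. f m j s k (?d p k)))"
    unfolding gram_index[OF J idx]
  proof (intro sum.cong refl arg_cong2[where f = "(*)"])
    fix p assume "p \<in> {..<(\<Prod>k<N. I k)}"
    then have p: "p < (\<Prod>k<N. I k)" by simp
    show "J $$ (p, (\<Sum>k<n. R * I k) + (r * I n + i)) = (\<Prod>k<N. f n i r k (?d p k))"
      unfolding J_def f_def using cp_model_jacobian_index[OF A p n i r] by (simp add: Let_def)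
    show "J $$ (p, (\<Sum>k<m. R * I k) + (s * I m + j)) = (\<Prod>k<N. f m j s k (?d p k))"
      unfolding J_def f_def using cp_model_jacobian_index[OF A p m j s] by (simp add: Let_def)
  qed
  also have "\<dots> = (\<Sum>p<(\<Prod>k<N. I k). \<Prod>k<N. f n i r k (?d p k) * f m j s k (?d p k))"
    by (simp only: prod.distrib)
  also have "\<dots> = (\<Prod>k<N. g k)"
    unfolding g_def by (rule sum_mixed_radix)
  also have "\<dots> = (\<Prod>k\<in>{n, m}. g k) * (\<Prod>k\<in>{..<N} - {n, m}. g k)"
    using n m by (subst prod.subset_diff[of "{n, m}"]) (auto simp: mult.commute)
  also have "(\<Prod>k\<in>{..<N} - {n, m}. g k) = (\<Prod>k\<in>{..<N} - {n, m}. C k $$ (r, s))"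
  proof (intro prod.cong refl)
    fix k assume k: "k \<in> {..<N} - {n, m}"
    then have "A k \<in> carrier_mat (I k) R" using A by simp
    from gram_index[OF this r s] k show "g k = C k $$ (r, s)"
      by (simp add: g_def f_def C_def del: index_mult_mat)
  qed
  also have "\<dots> = hadamard_prod R ({..<N} - {n, m}) C $$ (r, s)"
    using r s by (simp add: hadamard_prod_def)
  \<comment> \<open>For \<open>n = m\<close> the index set is a singleton and two unit vectors meet
    in one mode; otherwise each of the two modes contains one unit vector.\<close>
  also have "(\<Prod>k\<in>{n, m}. g k) = (if n = m then of_bool (i = j) else A n $$ (i, s) * A m $$ (j, r))"
  proof (cases "n = m")
    case True
    have "g m = (\<Sum>x<I m. if x = i then of_bool (i = j) else 0)"
      unfolding g_def f_def using True by (intro sum.cong refl) auto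
    then show ?thesis using True i by simp
  next
    case False
    have "g n = (\<Sum>x<I n. if x = i then A n $$ (i, s) else 0)"
      unfolding g_def f_def using False by (intro sum.cong refl) auto
    moreover have "g m = (\<Sum>x<I m. if x = j then A m $$ (j, r) else 0)"
      unfolding g_def f_def using False by (intro sum.cong refl) auto
    ultimately show ?thesis using False i j by simp
  qed
  finally show ?thesis .
qed

text \<open>Applied to \<open>\<Gamma> n n\<close>, this provides both its symmetry and, after
  damping, its invertibility. A product of inner products over modes is a single inner product over
  multi-indices.\<close>

lemma hadamard_prod_gram:
  fixes A :: "nat \<Rightarrow> real mat"
  assumes A: "\<And>k. k \<in> S \<Longrightarrow> A k \<in> carrier_mat (I k) R" and S: "S \<subseteq> {..<N}"
  obtains F m where "F \<in> carrier_mat m R"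
    "hadamard_prod R S (\<lambda>k. (A k)\<^sup>T * A k) = F\<^sup>T * F"
proof
  \<comment> \<open>\<open>F\<close> is the Khatri-Rao product of the \<open>A k\<close> with \<open>k \<in> S\<close>; modes outside \<open>S\<close> get size 1.\<close>
  define I' where "I' = (\<lambda>k. if k \<in> S then I k else 1)"
  define f where "f = (\<lambda>r k x. if k \<in> S then A k $$ (x, r) else 1)"
  define m where "m = (\<Prod>k<N. I' k)"
  define F where "F = Matrix.mat m R (\<lambda>(p, r). \<Prod>k<N. f r k (p div (\<Prod>l<k. I' l) mod I' k))"
  show F: "F \<in> carrier_mat m R" by (simp add: F_def)
  show "hadamard_prod R S (\<lambda>k. (A k)\<^sup>T * A k) = F\<^sup>T * F"
  proof (rule eq_matI)
    fix r s assume "r < dim_row (F\<^sup>T * F)" "s < dim_col (F\<^sup>T * F)"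
    then have rs: "r < R" "s < R" using F by auto
    have "(F\<^sup>T * F) $$ (r, s) = (\<Sum>p<m. \<Prod>k<N. f r k (p div (\<Prod>l<k. I' l) mod I' k) *
        f s k (p div (\<Prod>l<k. I' l) mod I' k))"
      unfolding gram_index[OF F rs] prod.distrib using rs by (intro sum.cong refl) (simp add: F_def)
    also have "\<dots> = (\<Prod>k<N. \<Sum>x<I' k. f r k x * f s k x)"
      unfolding m_def by (rule sum_mixed_radix)
    also have "\<dots> = (\<Prod>k<N. if k \<in> S then ((A k)\<^sup>T * A k) $$ (r, s) else 1)"
    proof (intro prod.cong refl)
      fix k
      show "(\<Sum>x<I' k. f r k x * f s k x) = (if k \<in> S then ((A k)\<^sup>T * A k) $$ (r, s) else 1)"
        using gram_index[OF A rs, of k] by (simp add: f_def I'_def del: index_mult_mat)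
    qed
    also have "\<dots> = (\<Prod>k\<in>S. ((A k)\<^sup>T * A k) $$ (r, s))"
      using S by (simp add: prod.inter_restrict[symmetric] Int_absorb1)
    finally show "hadamard_prod R S (\<lambda>k. (A k)\<^sup>T * A k) $$ (r, s) = (F\<^sup>T * F) $$ (r, s)"
      using rs by (simp add: hadamard_prod_def)
  qed (use F in \<open>auto simp: hadamard_prod_def\<close>)
qed

section \<open>The matrix \<open>K\<close> and its conjugation by the block diagonal
  \<open>Z\<close>\<close>

lemma block_mat_carrier: "block_mat N b M \<in> carrier_mat (N * b) (N * b)"
  by (simp add: block_mat_def)

lemma block_mat_index:
  assumes "n < N" "m < N" "u < b" "v < b"
  shows "block_mat N b M $$ (n * b + u, m * b + v) = M n m $$ (u, v)"
  using assms by (simp add: block_mat_def prod_index_less)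

text \<open>The diagonal factor scales columns, and the permutation has its only 1 in row
  \<open>(r, u)\<close> at column \<open>(u, r)\<close>. Position \<open>s * R + v\<close> of the
  vectorization holds entry \<open>(v, s)\<close>, hence the order of the indices of
  \<open>X\<close>.\<close>

lemma comm_mat_diag_index:
  assumes X: "X \<in> carrier_mat R R" and "r < R" "u < R" "s < R" "v < R"
  shows "(comm_mat R * diag_of_vec (vec_of_mat X)) $$ (r * R + u, s * R + v) =
    of_bool (u = s \<and> v = r) * X $$ (v, s)"
proof -
  have idx: "r * R + u < R * R" "s * R + v < R * R" using assms by (auto intro: prod_index_less)
  have "s * R + v = u * R + r \<longleftrightarrow> u = s \<and> v = r"
    using block_index_eq_iff[of v "\<lambda>_. R" s r u] assms by auto
  moreover have "comm_mat R \<in> carrier_mat (R * R) (R * R)"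
    by (simp add: comm_mat_def power2_eq_square)
  then have "comm_mat R * diag_of_vec (vec_of_mat X) =
      Matrix.mat (R * R) (R * R) (\<lambda>(i, j). comm_mat R $$ (i, j) * vec_of_mat X $ j)"
    using X mat_diag_mult_right[of "comm_mat R" "R * R" "R * R"]
    by (simp add: diag_of_vec_def vec_of_mat_def)
  ultimately show ?thesis
    using assms idx by (simp add: vec_of_mat_def comm_mat_def power2_eq_square)
qed

lemma kron_one_sum:
  assumes X: "X \<in> carrier_mat c d" and "r < a" "i < c"
  shows "(\<Sum>p<a * d. kron (1\<^sub>m a) X $$ (r * c + i, p) * f p) = (\<Sum>u<d. X $$ (i, u) * f (r * d + u))"
proof -
  have "(\<Sum>p<a * d. kron (1\<^sub>m a) X $$ (r * c + i, p) * f p) =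
      (\<Sum>t<a. \<Sum>u<d. if t = r then X $$ (i, u) * f (r * d + u) else 0)"
    unfolding sum_less_mult using assms
    by (intro sum.cong refl) (auto simp: kron_index[OF one_carrier_mat X])
  also have "\<dots> = (\<Sum>t<a. if t = r then \<Sum>u<d. X $$ (i, u) * f (r * d + u) else 0)"
    by (intro sum.cong refl) auto
  finally show ?thesis using assms by simp
qed

text \<open>The row of \<open>Z\<close> indexed by \<open>n\<close>, \<open>r\<close>,
  \<open>i\<close> is supported on the columns indexed by \<open>n\<close>, \<open>r\<close>,
  \<open>u\<close> with \<open>u < R\<close>. Only one \<open>R\<close> by \<open>R\<close> piece of
  \<open>K\<close> is therefore reached, and two sums of length \<open>R\<close> remain.\<close>

lemma blkdiag_kron_one_conj_index:
  fixes A :: "nat \<Rightarrow> real mat"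
  assumes A: "\<And>k. k < N \<Longrightarrow> A k \<in> carrier_mat (I k) R" and K: "K \<in> carrier_mat (N * R\<^sup>2) (N * R\<^sup>2)"
    and n: "n < N" and i: "i < I n" and r: "r < R" and m: "m < N" and j: "j < I m" and s: "s < R"
  defines "Z \<equiv> blkdiag N (\<lambda>n. kron (1\<^sub>m R) (A n))"
  shows "(Z * K * Z\<^sup>T) $$ ((\<Sum>k<n. R * I k) + (r * I n + i), (\<Sum>k<m. R * I k) + (s * I m + j)) =
    (\<Sum>u<R. A n $$ (i, u) * (\<Sum>v<R. A m $$ (j, v) * K $$ (n * R\<^sup>2 + (r * R + u), m * R\<^sup>2 + (s * R + v))))"
proof -
  have kA: "kron (1\<^sub>m R) (A k) \<in> carrier_mat (R * I k) (R * R)" if "k < N" for k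
    using A[OF that] by (intro kron_carrier) auto
  have kAT: "(kron (1\<^sub>m R) (A k))\<^sup>T \<in> carrier_mat (R * R) (R * I k)" if "k < N" for k
    using kA[OF that] by simp
  have Z: "Z \<in> carrier_mat (\<Sum>k<N. R * I k) (\<Sum>k<N. R * R)"
    unfolding Z_def using kA by (rule blkdiag_carrier)
  have ZT: "Z\<^sup>T = blkdiag N (\<lambda>n. (kron (1\<^sub>m R) (A n))\<^sup>T)"
    unfolding Z_def using kA by (rule blkdiag_transpose)
  have K': "K \<in> carrier_mat (\<Sum>k<N. R * R) (\<Sum>k<N. R * R)"
    using K by (simp add: power2_eq_square)
  let ?p = "(\<Sum>k<n. R * I k) + (r * I n + i)" and ?q = "(\<Sum>k<m. R * I k) + (s * I m + j)"
  have p: "r * I n + i < R * I n" and q: "s * I m + j < R * I m"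
    using assms by (auto intro: prod_index_less)
  have q': "?q < (\<Sum>k<N. R * I k)" using q m by (auto intro: block_index_less)
  have inner: "(K * Z\<^sup>T) $$ (w, ?q) = (\<Sum>v<R. A m $$ (j, v) * K $$ (w, m * R\<^sup>2 + (s * R + v)))"
    if w: "w < N * (R * R)" for w
  proof -
    have "(K * Z\<^sup>T) $$ (w, ?q) = (\<Sum>v<R * R. K $$ (w, m * (R * R) + v) * (kron (1\<^sub>m R) (A m))\<^sup>T $$ (v, s * I m + j))"
      using blkdiag_mult_right_index[of N _ "\<lambda>_. R * R" "\<lambda>k. R * I k", OF kAT K' m q, of w] w by (simp add: ZT)
    also have "\<dots> = (\<Sum>v<R * R. kron (1\<^sub>m R) (A m) $$ (s * I m + j, v) * K $$ (w, m * (R * R) + v))"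
      using kA[OF m] q by (intro sum.cong refl) (auto simp: mult.commute)
    also have "\<dots> = (\<Sum>v<R. A m $$ (j, v) * K $$ (w, m * R\<^sup>2 + (s * R + v)))"
      using kron_one_sum[OF A[OF m] s j, of "\<lambda>v. K $$ (w, m * (R * R) + v)"] by (simp add: power2_eq_square)
    finally show ?thesis .
  qed
  have KZ: "K * Z\<^sup>T \<in> carrier_mat (\<Sum>k<N. R * R) (\<Sum>k<N. R * I k)" using K' Z by simp
  have "(Z * K * Z\<^sup>T) $$ (?p, ?q) = (Z * (K * Z\<^sup>T)) $$ (?p, ?q)"
    using Z K' by (simp add: assoc_mult_mat[OF Z K'])
  also have "\<dots> = (\<Sum>w<R * R. kron (1\<^sub>m R) (A n) $$ (r * I n + i, w) * (K * Z\<^sup>T) $$ (n * (R * R) + w, ?q))"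
    using blkdiag_mult_left_index[of N _ "\<lambda>k. R * I k" "\<lambda>_. R * R", OF kA KZ n p q'] by (simp add: Z_def)
  also have "\<dots> = (\<Sum>u<R. A n $$ (i, u) * (K * Z\<^sup>T) $$ (n * (R * R) + (r * R + u), ?q))"
    by (rule kron_one_sum[OF A[OF n] r i])
  also have "\<dots> = (\<Sum>u<R. A n $$ (i, u) * (\<Sum>v<R. A m $$ (j, v) * K $$ (n * R\<^sup>2 + (r * R + u), m * R\<^sup>2 + (s * R + v))))"
  proof (intro sum.cong refl arg_cong2[where f = "(*)"])
    fix u assume "u \<in> {..<R}"
    then have "n * (R * R) + (r * R + u) < N * (R * R)"
      using n r by (intro prod_index_less) auto
    from inner[OF this] show "(K * Z\<^sup>T) $$ (n * (R * R) + (r * R + u), ?q) =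
        (\<Sum>v<R. A m $$ (j, v) * K $$ (n * R\<^sup>2 + (r * R + u), m * R\<^sup>2 + (s * R + v)))"
      by (simp add: power2_eq_square)
  qed
  finally show ?thesis .
qed

lemma hadamard_prod_carrier: "hadamard_prod R S M \<in> carrier_mat R R"
  by (simp add: hadamard_prod_def)

lemma eq_mat_block_indexI:
  fixes N :: nat
  assumes "X \<in> carrier_mat (\<Sum>k<N. R * I k) (\<Sum>k<N. R * I k)" "Y \<in> carrier_mat (\<Sum>k<N. R * I k) (\<Sum>k<N. R * I k)"
    and eq: "\<And>n r i m s j. n < N \<Longrightarrow> r < R \<Longrightarrow> i < I n \<Longrightarrow> m < N \<Longrightarrow> s < R \<Longrightarrow> j < I m \<Longrightarrow>
      X $$ ((\<Sum>k<n. R * I k) + (r * I n + i), (\<Sum>k<m. R * I k) + (s * I m + j)) =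
      Y $$ ((\<Sum>k<n. R * I k) + (r * I n + i), (\<Sum>k<m. R * I k) + (s * I m + j))"
  shows "X = Y"
proof (rule eq_matI)
  fix p q assume "p < dim_row Y" "q < dim_col Y"
  then have p: "p < (\<Sum>k<N. R * I k)" and q: "q < (\<Sum>k<N. R * I k)" using assms by auto
  from p obtain n i' where n: "n < N" "i' < R * I n" "p = (\<Sum>k<n. R * I k) + i'"
    by (rule block_index_cases)
  from n(2) obtain r i where i: "r < R" "i < I n" "i' = r * I n + i"
    by (rule prod_index_cases)
  from q obtain m j' where m: "m < N" "j' < R * I m" "q = (\<Sum>k<m. R * I k) + j'"
    by (rule block_index_cases)
  from m(2) obtain s j where j: "s < R" "j < I m" "j' = s * I m + j"
    by (rule prod_index_cases)
  show "X $$ (p, q) = Y $$ (p, q)"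
    unfolding n(3) i(3) m(3) j(3) using n(1) i(1,2) m(1) j(1,2) by (rule eq)
qed (use assms in auto)

text \<open>Entrywise comparison with \<open>cp_model_gram_index\<close>: the case
  \<open>n = m\<close> and the damping make up the Kronecker blocks, while the crossed entries with
  \<open>n \<noteq> m\<close> are those of \<open>Z * K * Z\<^sup>T\<close>.\<close>

lemma damped_gram_decomposition:
  fixes A :: "nat \<Rightarrow> real mat" and \<mu> :: real
  assumes A: "\<And>k. k < N \<Longrightarrow> A k \<in> carrier_mat (I k) R"
  defines "J \<equiv> jacobian (cp_model N I R) (cp_params N A)"
    and "\<Gamma> \<equiv> \<lambda>n m. hadamard_prod R ({..<N} - {n, m}) (\<lambda>k. (A k)\<^sup>T * A k)"
    and "Z \<equiv> blkdiag N (\<lambda>n. kron (1\<^sub>m R) (A n))"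
  defines "K \<equiv> block_mat N (R\<^sup>2) (\<lambda>n m.
      (1 - (if n = m then 1 else 0)) \<cdot>\<^sub>m (comm_mat R * diag_of_vec (vec_of_mat (\<Gamma> n m))))"
  shows "J\<^sup>T * J + \<mu> \<cdot>\<^sub>m 1\<^sub>m (\<Sum>k<N. R * I k) =
    blkdiag N (\<lambda>n. kron (\<Gamma> n n + \<mu> \<cdot>\<^sub>m 1\<^sub>m R) (1\<^sub>m (I n))) + Z * K * Z\<^sup>T"
    (is "?L = ?D + ?Q")
proof (rule eq_mat_block_indexI)
  let ?T = "\<Sum>k<N. R * I k"
  have J: "J \<in> carrier_mat (\<Prod>k<N. I k) ?T"
    unfolding J_def using A by (rule cp_model_jacobian_carrier)
  have NR: "(\<Sum>k<N. R * R) = N * R\<^sup>2" by (simp add: power2_eq_square)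
  have Z: "Z \<in> carrier_mat ?T (N * R\<^sup>2)"
    unfolding Z_def NR[symmetric] using A by (intro blkdiag_carrier kron_carrier) auto
  have K: "K \<in> carrier_mat (N * R\<^sup>2) (N * R\<^sup>2)"
    unfolding K_def by (rule block_mat_carrier)
  have \<Gamma>: "\<Gamma> n m \<in> carrier_mat R R" for n m
    unfolding \<Gamma>_def by (rule hadamard_prod_carrier)
  have blk: "kron (\<Gamma> n n + \<mu> \<cdot>\<^sub>m 1\<^sub>m R) (1\<^sub>m (I n)) \<in> carrier_mat (R * I n) (R * I n)" for n
    using \<Gamma>[of n n] by (intro kron_carrier) auto
  have D: "?D \<in> carrier_mat ?T ?T"
    using blk by (rule blkdiag_carrier)
  show "?L \<in> carrier_mat ?T ?T" using J by simp
  show "?D + ?Q \<in> carrier_mat ?T ?T" using D Z K by simp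
  fix n r i m s j assume nm: "n < N" "m < N" and rs: "r < R" "s < R" and ij: "i < I n" "j < I m"
  let ?p = "(\<Sum>k<n. R * I k) + (r * I n + i)" and ?q = "(\<Sum>k<m. R * I k) + (s * I m + j)"
  have p: "r * I n + i < R * I n" and q: "s * I m + j < R * I m"
    using rs ij by (auto intro: prod_index_less)
  have pq: "?p < ?T" "?q < ?T"
    using nm p q by (auto intro: block_index_less)
  have "?p = ?q \<longleftrightarrow> n = m \<and> r * I n + i = s * I m + j"
    using p q by (rule block_index_eq_iff)
  also have "\<dots> \<longleftrightarrow> n = m \<and> r = s \<and> i = j"
    using block_index_eq_iff[of i "\<lambda>_. I n" r j s] ij by auto
  finally have eq: "?p = ?q \<longleftrightarrow> n = m \<and> r = s \<and> i = j" .
  have L: "?L $$ (?p, ?q) = (if n = m then of_bool (i = j) else A n $$ (i, s) * A m $$ (j, r)) * \<Gamma> n m $$ (r, s)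
      + of_bool (n = m \<and> r = s \<and> i = j) * \<mu>"
  proof -
    have "?L $$ (?p, ?q) = (J\<^sup>T * J) $$ (?p, ?q) + of_bool (?p = ?q) * \<mu>"
      using J pq by (simp del: index_mult_mat(1))
    then show ?thesis
      unfolding eq using cp_model_gram_index[OF A nm(1) ij(1) rs(1) nm(2) ij(2) rs(2)]
      by (simp only: J_def \<Gamma>_def)
  qed
  have D': "?D $$ (?p, ?q) = (if n = m then (\<Gamma> n n $$ (r, s) + of_bool (r = s) * \<mu>) * of_bool (i = j) else 0)"
  proof (cases "n = m")
    case True
    have "?D $$ (?p, ?q) = kron (\<Gamma> n n + \<mu> \<cdot>\<^sub>m 1\<^sub>m R) (1\<^sub>m (I n)) $$ (r * I n + i, s * I n + j)"
      using blkdiag_index[of N "\<lambda>n. kron (\<Gamma> n n + \<mu> \<cdot>\<^sub>m 1\<^sub>m R) (1\<^sub>m (I n))", OF blk nm(1) p nm(2) q] True by simp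
    also have "\<dots> = (\<Gamma> n n + \<mu> \<cdot>\<^sub>m 1\<^sub>m R) $$ (r, s) * 1\<^sub>m (I n) $$ (i, j)"
      using \<Gamma>[of n n] rs ij True by (intro kron_index[of _ R R _ "I n" "I n"]) auto
    finally show ?thesis using True \<Gamma>[of n n] rs ij by simp
  next
    case False
    then show ?thesis
      using blkdiag_index[of N "\<lambda>n. kron (\<Gamma> n n + \<mu> \<cdot>\<^sub>m 1\<^sub>m R) (1\<^sub>m (I n))", OF blk nm(1) p nm(2) q] by simp
  qed
  have Q: "?Q $$ (?p, ?q) = (if n = m then 0 else A n $$ (i, s) * \<Gamma> n m $$ (r, s) * A m $$ (j, r))"
  proof -
    \<comment> \<open>Within the piece of \<open>K\<close> that is reached, only
      \<open>u = s\<close>, \<open>v = r\<close> survives. This collapses both sums and yields the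
      crossed factors \<open>A n $$ (i, s)\<close> and \<open>A m $$ (j, r)\<close>.\<close>
    have Kent: "K $$ (n * R\<^sup>2 + (r * R + u), m * R\<^sup>2 + (s * R + v)) =
        (if n \<noteq> m \<and> u = s \<and> v = r then \<Gamma> n m $$ (r, s) else 0)" if "u < R" "v < R" for u v
    proof -
      have uv: "r * R + u < R\<^sup>2" "s * R + v < R\<^sup>2"
        using rs that by (auto simp: power2_eq_square intro: prod_index_less)
      have carr: "comm_mat R * diag_of_vec (vec_of_mat (\<Gamma> n m)) \<in> carrier_mat (R\<^sup>2) (R\<^sup>2)"
        using \<Gamma>[of n m] unfolding comm_mat_def diag_of_vec_def vec_of_mat_def
        by (intro mult_carrier_mat[of _ _ "R\<^sup>2"]) (auto simp: mat_diag_def power2_eq_square)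
      have "K $$ (n * R\<^sup>2 + (r * R + u), m * R\<^sup>2 + (s * R + v)) = (1 - (if n = m then 1 else 0)) *
          (comm_mat R * diag_of_vec (vec_of_mat (\<Gamma> n m))) $$ (r * R + u, s * R + v)"
        unfolding K_def block_mat_index[OF nm uv] using carr uv by (intro index_smult_mat) auto
      also have "\<dots> = (1 - (if n = m then 1 else 0)) * (of_bool (u = s \<and> v = r) * \<Gamma> n m $$ (v, s))"
        by (subst comm_mat_diag_index[OF \<Gamma>]) (use rs that in auto)
      finally show ?thesis by auto
    qed
    have "?Q $$ (?p, ?q) = (\<Sum>u<R. A n $$ (i, u) *
        (\<Sum>v<R. A m $$ (j, v) * K $$ (n * R\<^sup>2 + (r * R + u), m * R\<^sup>2 + (s * R + v))))"
      unfolding Z_def by (rule blkdiag_kron_one_conj_index[OF A K nm(1) ij(1) rs(1) nm(2) ij(2) rs(2)])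
    also have "\<dots> = (\<Sum>u<R. A n $$ (i, u) * (\<Sum>v<R. if v = r then
        (if n \<noteq> m \<and> u = s then A m $$ (j, r) * \<Gamma> n m $$ (r, s) else 0) else 0))"
      by (intro sum.cong refl arg_cong2[where f = "(*)"]) (auto simp: Kent)
    also have "\<dots> = (\<Sum>u<R. if u = s then
        (if n \<noteq> m then A n $$ (i, s) * A m $$ (j, r) * \<Gamma> n m $$ (r, s) else 0) else 0)"
      using rs by (intro sum.cong refl) auto
    finally show ?thesis using rs by simp
  qed
  have "(?D + ?Q) $$ (?p, ?q) = ?D $$ (?p, ?q) + ?Q $$ (?p, ?q)"
    using pq Z by (intro index_add_mat) auto
  then show "?L $$ (?p, ?q) = (?D + ?Q) $$ (?p, ?q)"
    unfolding L D' Q by (auto simp: algebra_simps)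
qed

text \<open>As \<open>inverse_mat\<close> is unspecified on singular arguments, the conclusion also
  asserts that the matrices inverted in the formula are invertible.\<close>

theorem theorem4p3:
  fixes A :: "nat \<Rightarrow> real mat" and I :: "nat \<Rightarrow> nat" and N R T :: nat and \<mu> :: real
    and J H H\<mu> K \<Psi> B G L :: "real mat"
    and C \<Gamma>t :: "nat \<Rightarrow> real mat" and \<Gamma> :: "nat \<Rightarrow> nat \<Rightarrow> real mat"
  assumes "N \<ge> 2"
    and "\<And>n. n < N \<Longrightarrow> A n \<in> carrier_mat (I n) R"
    and "\<mu> > 0"
  defines "T \<equiv> \<Sum>n<N. I n"
    and "J \<equiv> jacobian (cp_model N I R) (cp_params N A)"
    and "H \<equiv> J\<^sup>T * J"
    and "C \<equiv> \<lambda>n. (A n)\<^sup>T * A n"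
    and "\<Gamma> \<equiv> \<lambda>n m. hadamard_prod R ({..<N} - {n, m}) C"
    and "\<Gamma>t \<equiv> \<lambda>n. inverse_mat (\<Gamma> n n + \<mu> \<cdot>\<^sub>m 1\<^sub>m R)"
    and "K \<equiv> block_mat N (R\<^sup>2) (\<lambda>n m.
           (1 - (if n = m then 1 else 0)) \<cdot>\<^sub>m (comm_mat R * diag_of_vec (vec_of_mat (\<Gamma> n m))))"
    and "\<Psi> \<equiv> blkdiag N (\<lambda>n. kron (\<Gamma>t n) (C n))"
    and "B \<equiv> (if invertible_mat K then inverse_mat (inverse_mat K + \<Psi>)
           else K * inverse_mat (1\<^sub>m (N * R\<^sup>2) + \<Psi> * K))"
    and "H\<mu> \<equiv> H + \<mu> \<cdot>\<^sub>m 1\<^sub>m (R * T)"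
    and "G \<equiv> blkdiag N (\<lambda>n. kron (\<Gamma>t n) (1\<^sub>m (I n)))"
    and "L \<equiv> blkdiag N (\<lambda>n. kron (\<Gamma>t n) (A n))"
  shows "(\<forall>n<N. invertible_mat (\<Gamma> n n + \<mu> \<cdot>\<^sub>m 1\<^sub>m R)) \<and>
    (if invertible_mat K then invertible_mat (inverse_mat K + \<Psi>)
     else invertible_mat (1\<^sub>m (N * R\<^sup>2) + \<Psi> * K)) \<and>
    invertible_mat H\<mu> \<and> inverse_mat H\<mu> = G - L * B * L\<^sup>T"
proof -
  note A = assms(2)
  let ?T = "\<Sum>k<N. R * I k" and ?M = "\<lambda>n. \<Gamma> n n + \<mu> \<cdot>\<^sub>m 1\<^sub>m R"
  define Z where "Z = blkdiag N (\<lambda>n. kron (1\<^sub>m R) (A n))"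
  define D where "D = blkdiag N (\<lambda>n. kron (?M n) (1\<^sub>m (I n)))"
  have T: "R * T = ?T" by (simp add: T_def sum_distrib_left)
  have NR: "(\<Sum>k<N. R * R) = N * R\<^sup>2" by (simp add: power2_eq_square)
  have M: "?M n \<in> carrier_mat R R" for n
    by (simp add: \<Gamma>_def hadamard_prod_carrier)
  have gram: "invertible_mat (?M n) \<and> (?M n)\<^sup>T = ?M n" for n
  proof -
    obtain F m where F: "F \<in> carrier_mat m R" and "\<Gamma> n n = F\<^sup>T * F"
      unfolding \<Gamma>_def C_def
      by (rule hadamard_prod_gram[of "{..<N} - {n, n}" A I R N]) (use A in auto)
    then have eq: "?M n = F\<^sup>T * F + \<mu> \<cdot>\<^sub>m 1\<^sub>m R" by simp
    have "(F\<^sup>T * F)\<^sup>T = F\<^sup>T * F" using F by (simp add: transpose_mult[of _ R m _ R])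
    then have "(?M n)\<^sup>T = ?M n"
      using F unfolding eq by (subst transpose_add[of _ R R]) auto
    then show ?thesis
      using gram_plus_smult_one_invertible[OF F \<open>\<mu> > 0\<close>] by (simp add: eq)
  qed
  have \<Gamma>t: "\<Gamma>t n \<in> carrier_mat R R" and M\<Gamma>t: "?M n * \<Gamma>t n = 1\<^sub>m R" and \<Gamma>tT: "(\<Gamma>t n)\<^sup>T = \<Gamma>t n" for n
    using inverse_mat_inverts[OF conjunct1[OF gram[of n]] M]
      inverse_mat_transpose[OF M conjunct1[OF gram[of n]] conjunct2[OF gram[of n]]]
    by (simp_all add: \<Gamma>t_def)
  have kM: "kron (?M n) (1\<^sub>m (I n)) \<in> carrier_mat (R * I n) (R * I n)" for n
    using M by (intro kron_carrier) auto
  have kG: "kron (\<Gamma>t n) (1\<^sub>m (I n)) \<in> carrier_mat (R * I n) (R * I n)" for n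
    using \<Gamma>t by (intro kron_carrier) auto
  have kZ: "kron (1\<^sub>m R) (A n) \<in> carrier_mat (R * I n) (R * R)" if "n < N" for n
    using A[OF that] by (intro kron_carrier) auto
  have kZT: "kron (1\<^sub>m R) (A n)\<^sup>T \<in> carrier_mat (R * R) (R * I n)" if "n < N" for n
    using A[OF that] by (intro kron_carrier) auto
  have kL: "kron (\<Gamma>t n) (A n) \<in> carrier_mat (R * I n) (R * R)" if "n < N" for n
    using A[OF that] \<Gamma>t by (intro kron_carrier) auto
  have kLT: "kron (\<Gamma>t n) (A n)\<^sup>T \<in> carrier_mat (R * R) (R * I n)" if "n < N" for n
    using A[OF that] \<Gamma>t by (intro kron_carrier) auto
  have D: "D \<in> carrier_mat ?T ?T" unfolding D_def using kM by (rule blkdiag_carrier)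
  have G: "G \<in> carrier_mat ?T ?T" unfolding G_def using kG by (rule blkdiag_carrier)
  have Z: "Z \<in> carrier_mat ?T (N * R\<^sup>2)"
    unfolding Z_def NR[symmetric] using kZ by (rule blkdiag_carrier)
  have K: "K \<in> carrier_mat (N * R\<^sup>2) (N * R\<^sup>2)" unfolding K_def by (rule block_mat_carrier)
  have ZT: "Z\<^sup>T = blkdiag N (\<lambda>n. kron (1\<^sub>m R) (A n)\<^sup>T)"
  proof -
    have "Z\<^sup>T = blkdiag N (\<lambda>n. (kron (1\<^sub>m R) (A n))\<^sup>T)"
      unfolding Z_def using kZ by (rule blkdiag_transpose)
    also have "\<dots> = blkdiag N (\<lambda>n. kron (1\<^sub>m R) (A n)\<^sup>T)"
      by (intro blkdiag_cong) (simp add: kron_transpose[OF one_carrier_mat A])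
    finally show ?thesis .
  qed
  \<comment> \<open>Symmetry of \<open>\<Gamma>t n\<close> enters here: transposing a block changes
    only its second Kronecker factor.\<close>
  have LT: "L\<^sup>T = blkdiag N (\<lambda>n. kron (\<Gamma>t n) (A n)\<^sup>T)"
  proof -
    have "L\<^sup>T = blkdiag N (\<lambda>n. (kron (\<Gamma>t n) (A n))\<^sup>T)"
      unfolding L_def using kL by (rule blkdiag_transpose)
    also have "\<dots> = blkdiag N (\<lambda>n. kron (\<Gamma>t n) (A n)\<^sup>T)"
      by (intro blkdiag_cong) (simp add: kron_transpose[OF \<Gamma>t A] \<Gamma>tT)
    finally show ?thesis .
  qed
  have DG: "D * G = 1\<^sub>m ?T"
  proof -
    have "D * G = blkdiag N (\<lambda>n. kron (?M n) (1\<^sub>m (I n)) * kron (\<Gamma>t n) (1\<^sub>m (I n)))"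
      unfolding D_def G_def using kM kG by (rule blkdiag_mult)
    also have "\<dots> = blkdiag N (\<lambda>n. 1\<^sub>m (R * I n))"
      by (intro blkdiag_cong)
        (simp add: kron_mult[OF M one_carrier_mat \<Gamma>t one_carrier_mat] M\<Gamma>t kron_one)
    finally show ?thesis by (simp add: blkdiag_one)
  qed
  have GZ: "G * Z = L"
  proof -
    have "G * Z = blkdiag N (\<lambda>n. kron (\<Gamma>t n) (1\<^sub>m (I n)) * kron (1\<^sub>m R) (A n))"
      unfolding G_def Z_def using kG kZ by (rule blkdiag_mult)
    also have "\<dots> = L"
      unfolding L_def by (intro blkdiag_cong)
        (simp add: kron_mult[OF \<Gamma>t one_carrier_mat one_carrier_mat A]
          right_mult_one_mat[OF \<Gamma>t] left_mult_one_mat[OF A])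
    finally show ?thesis .
  qed
  have ZTG: "Z\<^sup>T * G = L\<^sup>T"
  proof -
    have "Z\<^sup>T * G = blkdiag N (\<lambda>n. kron (1\<^sub>m R) (A n)\<^sup>T * kron (\<Gamma>t n) (1\<^sub>m (I n)))"
      unfolding G_def ZT using kZT kG by (rule blkdiag_mult)
    also have "\<dots> = L\<^sup>T"
      unfolding LT
    proof (intro blkdiag_cong)
      fix n assume "n < N"
      then have "(A n)\<^sup>T \<in> carrier_mat R (I n)" using A by simp
      then show "kron (1\<^sub>m R) (A n)\<^sup>T * kron (\<Gamma>t n) (1\<^sub>m (I n)) = kron (\<Gamma>t n) (A n)\<^sup>T"
        using \<Gamma>t[of n] by (simp add: kron_mult[OF one_carrier_mat _ \<Gamma>t one_carrier_mat])
    qed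
    finally show ?thesis .
  qed
  have \<Psi>: "Z\<^sup>T * G * Z = \<Psi>"
  proof -
    have "Z\<^sup>T * G * Z = blkdiag N (\<lambda>n. kron (\<Gamma>t n) (A n)\<^sup>T * kron (1\<^sub>m R) (A n))"
      unfolding ZTG unfolding LT Z_def using kLT kZ by (rule blkdiag_mult)
    also have "\<dots> = \<Psi>"
      unfolding \<Psi>_def C_def
    proof (intro blkdiag_cong)
      fix n assume n: "n < N"
      then have "(A n)\<^sup>T \<in> carrier_mat R (I n)" using A by simp
      then show "kron (\<Gamma>t n) (A n)\<^sup>T * kron (1\<^sub>m R) (A n) = kron (\<Gamma>t n) ((A n)\<^sup>T * A n)"
        using \<Gamma>t[of n] by (simp add: kron_mult[OF \<Gamma>t _ one_carrier_mat A[OF n]])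
    qed
    finally show ?thesis .
  qed
  have \<Psi>c: "\<Psi> \<in> carrier_mat (N * R\<^sup>2) (N * R\<^sup>2)" using Z G by (simp add: \<Psi>[symmetric])
  have J: "J \<in> carrier_mat (\<Prod>k<N. I k) ?T"
    unfolding J_def using A by (rule cp_model_jacobian_carrier)
  have H\<mu>: "H\<mu> = D + Z * K * Z\<^sup>T"
    using damped_gram_decomposition[OF A, where \<mu> = \<mu>]
    unfolding H\<mu>_def H_def J_def T D_def Z_def K_def \<Gamma>_def C_def .
  have inv: "invertible_mat H\<mu>"
    unfolding H\<mu>_def H_def T by (rule gram_plus_smult_one_invertible[OF J \<open>\<mu> > 0\<close>])
  \<comment> \<open>Rewriting with \<open>\<Psi>\<close>, \<open>GZ\<close> and \<open>ZTG\<close>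
    turns the general identity into the stated one, with \<open>L\<close> and its transpose as outer
    factors.\<close>
  note W = woodbury[OF D G Z K DG inv[unfolded H\<mu>], unfolded \<Psi>, unfolded GZ ZTG, folded H\<mu>]
  have B: "B = K * inverse_mat (1\<^sub>m (N * R\<^sup>2) + \<Psi> * K)"
    using inverse_inverse_mat_add(2)[OF K \<Psi>c _ W(1)] by (simp add: B_def)
  show ?thesis
    using gram inv W inverse_inverse_mat_add(1)[OF K \<Psi>c _ W(1)] by (simp add: B)
qed

end
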